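(* Consider the system of $N^d$ scalar agents interacting over a $d$-dimensional torus network, $$\tilde x_{t+1}=\left(aI-(\mu+\xi(t))gL_{N,k,d}\right)\tilde x_t-\tilde\phi(\tilde x_t)+v_t ,$$ and let $a_0=a-\frac1\delta$. (i) The system is mean square exponentially synchronizing if there exist scalars $p_i$ with $\delta>p_i>0$ for $i\in\{2,3,\dots,N^d\}$ such that, for all $i$, $$p_i>\frac{(a_0-\mu\tilde\lambda_ig)^2\delta p_i}{\delta-p_i}+\tilde\lambda_i^2\sigma^2\frac{g^2\delta p_i}{\delta-p_i}+\frac1\delta .$$ (ii) The conditions in (i) are satisfied (i.e. such $p_i$ exist) if and only if $$\left(1-\frac1\delta\right)^2>\max\{\alpha_2^2,\alpha_{N^d}^2\},$$ where $\alpha_i^2:=(a_0-\mu\tilde\lambda_ig)^2+\sigma^2\tilde\lambda_i^2g^2$ for $i\in\{2,\dots,N^d\}$. Accordingly, the margin of synchronization for a given variance of uncertainty is defined as $$\rho_{SM}:=1-\sigma^2\left(\frac{\tilde\lambda_{sup}^2g^2}{\left(1-\frac1\delta\right)^2-\left(a_0-\mu\tilde\lambda_{sup}g\right)^2}\right),\qquad \tilde\lambda_{sup}=\arg\max_{\tilde\lambda_2,\tilde\lambda_{N^d}}\alpha_i^2 .$$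
   Context: Each agent has a scalar state $x^k_t\in\mathbb{R}$, and $\tilde x_t\in\mathbb{R}^{N^d}$ stacks the states; $a,g,\mu\in\mathbb{R}$. $\tilde\phi(\tilde x_t)$ stacks the values $\phi(x^k_t,t)$. $v_t$ is zero-mean additive noise with covariance $R_v$. All links have the same mean weight $\mu$ and are affected by the same scalar uncertainty $\xi(t)$, zero mean, i.i.d. in time, with variance $\sigma^2$. (This is the case $A=a$, $B=1$, $C=1$, $G=g$, $D=\delta/2$ of a network of Lur'e systems, with $\delta>0$.) Torus Laplacian: $L_{N,k,1}$ is the (unweighted) Laplacian of the nearest-neighbour network of $N$ agents on a ring, each connected to its $k$ nearest neighbours, and $L_{N,k,d}=\sum_{i=0}^{d-1}I_{N^{d-1-i}}\otimes L_{N,k,1}\otimes I_{N^i}$. Its eigenvalues are $0=\tilde\lambda_1<\tilde\lambda_2\le\dots\le\tilde\lambda_{N^d}$. Nonlinearity: $\phi(\cdot,t):\mathbb{R}\to\mathbb{R}$ is globally Lipschitz, $C^1$ and monotonically nondecreasing, with $\phi(y,t)\left(y-\frac\delta2\phi(y,t)\right)>0$ for $y\ne0$ (and $\ge0$ at $y=0$), and $(\phi(y,t)-\phi(y',t))\left((y-y')-\frac\delta2(\phi(y,t)-\phi(y',t))\right)>0$ for $y\neq y'$. Mean square exponential synchronization: there exist $0<\beta<1$, $\bar K(\tilde e_0)>0$ and $c>0$ such that $E|x^k_t-x^j_t|^2\le\bar K(\tilde e_0)\beta^t|x^k_0-x^j_0|^2+c\|R_v\|$ for all agents $k,j$, where $\tilde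 e_0$ is a function of the differences $|x^i_0-x^\ell_0|^2$ over all pairs of agents $i,\ell$, and $\bar K(0)=K$ for some constant $K$. Expectations are over all randomness driving the system.
   Formalization: In (ii) the "if" direction is stated only for δ ≥ 1 (it fails for δ < 1); the synchronization bound is not required for pairs with equal initial states when the whole initial state is not synchronized (it is false there); ξ and v are taken independent. *)

theory Defs
  imports "HOL-Probability.Probability" "Jordan_Normal_Form.Char_Poly"
begin

(* Vectors and matrices are those of Jordan_Normal_Form, because the dimension N ^ d
   depends on term-level parameters. *)
unbundle no vec_syntax
hide_type (open) Finite_Cartesian_Product.vec

definition ring_dist :: "nat \<Rightarrow> nat \<Rightarrow> nat \<Rightarrow> nat" where
  "ring_dist N i j = min ((i + N - j) mod N) ((j + N - i) mod N)"

(* j is one of the k nearest neighbours of i iff fewer than k other agents are strictly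
   closer to i.  For even k < N this is k/2 agents on each side.  For odd k two agents may
   tie for the last place; both are then included, which keeps the graph undirected.
   A ring with k neighbours on each side is the instance 2 * k. *)
definition ring_adj :: "nat \<Rightarrow> nat \<Rightarrow> nat \<Rightarrow> nat \<Rightarrow> bool" where
  "ring_adj N k i j \<longleftrightarrow>
     i \<noteq> j \<and> card {l. l < N \<and> l \<noteq> i \<and> ring_dist N i l < ring_dist N i j} < k"

definition ring_laplacian :: "nat \<Rightarrow> nat \<Rightarrow> real mat" where
  "ring_laplacian N k = mat N N (\<lambda>(i, j).
     if i = j then real (card {l. l < N \<and> ring_adj N k i l})
     else if ring_adj N k i j then -1 else 0)"

definition kronecker :: "'a::semiring_0 mat \<Rightarrow> 'a mat \<Rightarrow> 'a mat" where
  "kronecker A B = mat (dim_row A * dim_row B) (dim_col A * dim_col B) (\<lambda>(i, j).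
     A $$ (i div dim_row B, j div dim_col B) * B $$ (i mod dim_row B, j mod dim_col B))"

(* The matrix sum is taken entrywise since the type of matrices has no zero element. *)
definition torus_laplacian :: "nat \<Rightarrow> nat \<Rightarrow> nat \<Rightarrow> real mat" where
  "torus_laplacian N k d = mat (N ^ d) (N ^ d) (\<lambda>rc.
     \<Sum>i<d. kronecker (kronecker (1\<^sub>m (N ^ (d - 1 - i))) (ring_laplacian N k))
               (1\<^sub>m (N ^ i)) $$ rc)"

(* lam 1, ..., lam n are the eigenvalues of A with multiplicity, in nondecreasing order. *)
definition ordered_eigenvalues :: "real mat \<Rightarrow> nat \<Rightarrow> (nat \<Rightarrow> real) \<Rightarrow> bool" where
  "ordered_eigenvalues A n lam \<longleftrightarrow>
     mono_on {1..n} lam \<and> char_poly A = (\<Prod>i = 1..n. [:- lam i, 1:])"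

(* At y = 0 the non-strict sector condition says - \<delta>/2 * \<phi>(0,t)^2 \<ge> 0. *)
definition admissible_nonlinearity :: "real \<Rightarrow> (real \<Rightarrow> nat \<Rightarrow> real) \<Rightarrow> bool" where
  "admissible_nonlinearity \<delta> \<phi> \<longleftrightarrow> (\<forall>t.
     (\<exists>C. C-lipschitz_on UNIV (\<lambda>y. \<phi> y t)) \<and>
     (\<lambda>y. \<phi> y t) C1_differentiable_on UNIV \<and>
     mono (\<lambda>y. \<phi> y t) \<and>
     (\<forall>y. y \<noteq> 0 \<longrightarrow> \<phi> y t * (y - \<delta> / 2 * \<phi> y t) > 0) \<and>
     \<phi> 0 t * (0 - \<delta> / 2 * \<phi> 0 t) \<ge> 0 \<and>
     (\<forall>y y'. y \<noteq> y' \<longrightarrow>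
        (\<phi> y t - \<phi> y' t) * ((y - y') - \<delta> / 2 * (\<phi> y t - \<phi> y' t)) > 0))"

definition link_uncertainty :: "'w measure \<Rightarrow> (nat \<Rightarrow> 'w \<Rightarrow> real) \<Rightarrow> real \<Rightarrow> bool" where
  "link_uncertainty M \<xi> \<sigma> \<longleftrightarrow>
     prob_space.indep_vars M (\<lambda>_. borel) \<xi> UNIV \<and>
     (\<forall>s t. distr M borel (\<xi> s) = distr M borel (\<xi> t)) \<and>
     (\<forall>t. integrable M (\<lambda>w. (\<xi> t w)\<^sup>2) \<and>
          prob_space.expectation M (\<xi> t) = 0 \<and>
          prob_space.variance M (\<xi> t) = \<sigma>\<^sup>2)"

(* v t k is the k-th component of the noise at time t.  Nothing is assumed about the
   dependence between different times. *)
definition additive_noise ::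
    "'w measure \<Rightarrow> nat \<Rightarrow> (nat \<Rightarrow> nat \<Rightarrow> 'w \<Rightarrow> real) \<Rightarrow> real mat \<Rightarrow> bool" where
  "additive_noise M n v R \<longleftrightarrow>
     R \<in> carrier_mat n n \<and>
     (\<forall>t. \<forall>k<n. v t k \<in> borel_measurable M \<and> integrable M (\<lambda>w. (v t k w)\<^sup>2) \<and>
                prob_space.expectation M (v t k) = 0) \<and>
     (\<forall>t. \<forall>k<n. \<forall>j<n. prob_space.expectation M (\<lambda>w. v t k w * v t j w) = R $$ (k, j))"

(* indep_var wants both arguments to have the same type, hence the dummy index 0 for the
   scalar process. *)
definition independent_processes ::
    "'w measure \<Rightarrow> nat \<Rightarrow> (nat \<Rightarrow> 'w \<Rightarrow> real) \<Rightarrow> (nat \<Rightarrow> nat \<Rightarrow> 'w \<Rightarrow> real) \<Rightarrow> bool" where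
  "independent_processes M n \<xi> v \<longleftrightarrow>
     prob_space.indep_var M
       (Pi\<^sub>M (UNIV \<times> {0}) (\<lambda>_. borel)) (\<lambda>w. \<lambda>(t, k)\<in>UNIV \<times> {0}. \<xi> t w)
       (Pi\<^sub>M (UNIV \<times> {..<n}) (\<lambda>_. borel)) (\<lambda>w. \<lambda>(t, k)\<in>UNIV \<times> {..<n}. v t k w)"

primrec network_state ::
    "real mat \<Rightarrow> real \<Rightarrow> real \<Rightarrow> real \<Rightarrow> (real \<Rightarrow> nat \<Rightarrow> real) \<Rightarrow> (nat \<Rightarrow> 'w \<Rightarrow> real) \<Rightarrow>
     (nat \<Rightarrow> nat \<Rightarrow> 'w \<Rightarrow> real) \<Rightarrow> real vec \<Rightarrow> nat \<Rightarrow> 'w \<Rightarrow> real vec" where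
  "network_state L a g \<mu> \<phi> \<xi> v x0 0 w = x0"
| "network_state L a g \<mu> \<phi> \<xi> v x0 (Suc t) w =
     (a \<cdot>\<^sub>m 1\<^sub>m (dim_row L) - ((\<mu> + \<xi> t w) * g) \<cdot>\<^sub>m L) *\<^sub>v network_state L a g \<mu> \<phi> \<xi> v x0 t w
     - map_vec (\<lambda>y. \<phi> y t) (network_state L a g \<mu> \<phi> \<xi> v x0 t w)
     + vec (dim_row L) (\<lambda>k. v t k w)"

definition euclidean_norm :: "real vec \<Rightarrow> real" where
  "euclidean_norm x = sqrt (x \<bullet> x)"

definition spectral_norm :: "real mat \<Rightarrow> real" where
  "spectral_norm A =
     (SUP x\<in>{x \<in> carrier_vec (dim_col A). euclidean_norm x \<le> 1}. euclidean_norm (A *\<^sub>v x))"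

definition initial_differences :: "nat \<Rightarrow> real vec \<Rightarrow> real mat" where
  "initial_differences n x0 = mat n n (\<lambda>(i, l). (x0 $ i - x0 $ l)\<^sup>2)"

(* X x0 t w is the state at time t from the deterministic initial state x0.  The constants do
   not depend on x0, t or the pair; the prefactor Kbar depends on x0 through the squared
   initial differences of all pairs.

   A pair starting from equal values within an initial state that is not synchronized is
   exempt: Kbar is finite, so the right-hand side would be c * spectral_norm R for it, although
   other agents can drive the two apart.  Nothing is lost: comparing both agents of such a pair
   with a third one starting elsewhere bounds them by
   4 * Kbar e0 * \<beta> ^ t * (x0 $ k - x0 $ i)^2 + 4 * c * spectral_norm R. *)
definition mean_square_exp_synchronizing ::
    "'w measure \<Rightarrow> nat \<Rightarrow> (real vec \<Rightarrow> nat \<Rightarrow> 'w \<Rightarrow> real vec) \<Rightarrow> real mat \<Rightarrow> bool" where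
  "mean_square_exp_synchronizing M n X R \<longleftrightarrow>
     (\<exists>\<beta> K c. \<exists>Kbar :: real mat \<Rightarrow> real.
        0 < \<beta> \<and> \<beta> < 1 \<and> 0 < c \<and> (\<forall>e. 0 < Kbar e) \<and> Kbar (0\<^sub>m n n) = K \<and>
        (\<forall>x0 \<in> carrier_vec n. \<forall>k<n. \<forall>j<n.
           x0 $ k \<noteq> x0 $ j \<or> (\<forall>i<n. \<forall>l<n. x0 $ i = x0 $ l) \<longrightarrow>
           (\<forall>t. integrable M (\<lambda>w. (X x0 t w $ k - X x0 t w $ j)\<^sup>2) \<and>
                prob_space.expectation M (\<lambda>w. (X x0 t w $ k - X x0 t w $ j)\<^sup>2)
                  \<le> Kbar (initial_differences n x0) * \<beta> ^ t * (x0 $ k - x0 $ j)\<^sup>2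
                     + c * spectral_norm R)))"

(* For n \<ge> 2 this forces p i > 1 / \<delta> and hence \<delta> > 1, so for \<delta> < 1 no bound on
   alpha_sq can imply that some p satisfies it: with a = 2, g = 0, \<delta> = 1/2 alpha_sq vanishes
   and (1 - 1 / \<delta>)^2 = 1, but p i > 2 contradicts p i < 1/2. *)
definition sync_condition ::
    "real \<Rightarrow> real \<Rightarrow> real \<Rightarrow> real \<Rightarrow> real \<Rightarrow> (nat \<Rightarrow> real) \<Rightarrow> nat \<Rightarrow> (nat \<Rightarrow> real) \<Rightarrow> bool" where
  "sync_condition a g \<mu> \<sigma> \<delta> lam n p \<longleftrightarrow> (\<forall>i\<in>{2..n}.
     \<delta> > p i \<and> p i > 0 \<and>
     p i > ((a - 1 / \<delta>) - \<mu> * lam i * g)\<^sup>2 * \<delta> * p i / (\<delta> - p i)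
           + (lam i)\<^sup>2 * \<sigma>\<^sup>2 * (g\<^sup>2 * \<delta> * p i / (\<delta> - p i)) + 1 / \<delta>)"

definition alpha_sq :: "real \<Rightarrow> real \<Rightarrow> real \<Rightarrow> real \<Rightarrow> real \<Rightarrow> real \<Rightarrow> real" where
  "alpha_sq a g \<mu> \<sigma> \<delta> l =
     ((a - 1 / \<delta>) - \<mu> * l * g)\<^sup>2 + \<sigma>\<^sup>2 * l\<^sup>2 * g\<^sup>2"

(* In case of a tie arg_max_on picks an unspecified one of the two eigenvalues. *)
definition lambda_sup ::
    "real \<Rightarrow> real \<Rightarrow> real \<Rightarrow> real \<Rightarrow> real \<Rightarrow> (nat \<Rightarrow> real) \<Rightarrow> nat \<Rightarrow> real" where
  "lambda_sup a g \<mu> \<sigma> \<delta> lam n =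
     arg_max_on (alpha_sq a g \<mu> \<sigma> \<delta>) {lam 2, lam n}"

definition sync_margin ::
    "real \<Rightarrow> real \<Rightarrow> real \<Rightarrow> real \<Rightarrow> real \<Rightarrow> (nat \<Rightarrow> real) \<Rightarrow> nat \<Rightarrow> real" where
  "sync_margin a g \<mu> \<sigma> \<delta> lam n =
     (let l = lambda_sup a g \<mu> \<sigma> \<delta> lam n in
      1 - \<sigma>\<^sup>2 * (l\<^sup>2 * g\<^sup>2 / ((1 - 1 / \<delta>)\<^sup>2 - ((a - 1 / \<delta>) - \<mu> * l * g)\<^sup>2)))"

end

theory Submission
  imports Defs
begin

text \<open>
Why the theorem holds. The sector and slope conditions say that every increment of \<open>\<phi>\<close> lies
between \<open>0\<close> and \<open>2 / \<delta>\<close> times the increment of its argument. Subtracting the midpoint slope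
\<open>1 / \<delta>\<close> turns \<open>\<phi>\<close> into a map with Lipschitz constant \<open>1 / \<delta>\<close> and turns the linear gain \<open>a\<close>
into \<open>a - 1 / \<delta>\<close>, the number \<open>a\<^sub>0\<close> of the statement.

Progress is measured by the disagreement, the sum of \<open>(x\<^sub>i - x\<^sub>j)\<^sup>2\<close> over all pairs, which is
\<open>2 n\<close> times the squared distance of \<open>x\<close> from the synchronized states. One time step adds three
contributions. The random linear part multiplies the expected disagreement by at most
\<open>\<alpha> = max \<alpha>\<^sub>i\<^sup>2\<close> (\<open>expectation_linear_part\<close>). For this step the uncertainty \<open>\<xi>(t)\<close> has to be
independent of the state at time \<open>t\<close> (\<open>uncertainty_indep_of_state\<close>), which removes the term
linear in \<open>\<xi>(t)\<close> and leaves \<open>\<sigma>\<^sup>2\<close> in the quadratic one. The rest of that bound is spectral: the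
Laplacian is symmetric, so it is orthogonally diagonalizable, and the synchronized direction
carries its smallest eigenvalue, so only the eigenvalues with index at least \<open>2\<close> matter
(\<open>disagreement_spectral_bound\<close>). The centred nonlinearity multiplies the disagreement by at most
\<open>1 / \<delta>\<^sup>2\<close>, and the noise adds a multiple of the norm of its covariance.

The three are combined by the convexity estimate
\<open>(x + y + z)\<^sup>2 \<le> x\<^sup>2 / p + y\<^sup>2 / q + z\<^sup>2 / r\<close> for positive weights of sum \<open>1\<close>, pathwise and hence for
arbitrarily correlated noise. Taking \<open>p = \<rho>\<close> with
\<open>sqrt \<alpha> < \<rho> < 1 - 1 / \<delta>\<close> and \<open>q = 1 / \<delta>\<close>, the expected disagreement contracts by the factor
\<open>\<rho> + 1 / \<delta> < 1\<close> up to a constant (\<open>expected_disagreement_Suc\<close>). Such a \<open>\<rho>\<close> exists exactly when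
\<open>\<delta> > 1\<close> and \<open>\<alpha> < (1 - 1 / \<delta>)\<^sup>2\<close>.

It remains to compare this with the condition on the \<open>p\<^sub>i\<close>. Solved for \<open>\<alpha>\<^sub>i\<^sup>2\<close>, the latter reads
\<open>\<alpha>\<^sub>i\<^sup>2 < (1 - 1 / \<delta>)\<^sup>2 - (p\<^sub>i - 1)\<^sup>2 / (\<delta> p\<^sub>i)\<close>, so \<open>p\<^sub>i = 1\<close> is the best choice. As \<open>\<alpha>\<^sub>i\<^sup>2\<close> is a
convex function of the eigenvalue, its maximum is attained at the second or at the last one.
\<close>

section \<open>Disagreement of a network state\<close>

definition disagreement :: "nat \<Rightarrow> (nat \<Rightarrow> real) \<Rightarrow> real" where
  "disagreement n x = (\<Sum>i<n. \<Sum>j<n. (x i - x j)\<^sup>2)"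

definition codisagreement :: "nat \<Rightarrow> (nat \<Rightarrow> real) \<Rightarrow> (nat \<Rightarrow> real) \<Rightarrow> real" where
  "codisagreement n x y = (\<Sum>i<n. \<Sum>j<n. (x i - x j) * (y i - y j))"

lemma disagreement_nonneg: "0 \<le> disagreement n x"
  by (simp add: disagreement_def sum_nonneg)

lemma pair_le_disagreement:
  assumes "k < n" "j < n"
  shows "(x k - x j)\<^sup>2 \<le> disagreement n x"
proof -
  have "(x k - x j)\<^sup>2 \<le> (\<Sum>j<n. (x k - x j)\<^sup>2)"
    using assms by (intro member_le_sum) auto
  also have "\<dots> \<le> disagreement n x"
    unfolding disagreement_def using assms by (intro member_le_sum) (auto intro: sum_nonneg)
  finally show ?thesis .
qed

text \<open>
This is \<open>2 n\<close> times the squared distance from the synchronized states. On vectors of mean zero only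
the Euclidean norm remains, which is the form that a diagonalization can handle.
\<close>

lemma disagreement_eq_variance:
  "disagreement n x = 2 * real n * (\<Sum>i<n. (x i)\<^sup>2) - 2 * (\<Sum>i<n. x i)\<^sup>2"
proof -
  have "disagreement n x = (\<Sum>i<n. \<Sum>j<n. (x i)\<^sup>2 + (x j)\<^sup>2 - 2 * (x i * x j))"
    unfolding disagreement_def by (simp add: power2_diff algebra_simps)
  also have "\<dots> = 2 * real n * (\<Sum>i<n. (x i)\<^sup>2) - 2 * ((\<Sum>i<n. x i) * (\<Sum>j<n. x j))"
    by (simp add: sum.distrib sum_subtractf sum_product sum_distrib_left algebra_simps)
  finally show ?thesis by (simp add: power2_eq_square)
qed

text \<open>
Polarization: the linear part of the dynamics is of this form with \<open>s\<close> a multiple of the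
uncertainty, whose first and second moments are known.
\<close>

lemma disagreement_diff_scaled:
  "disagreement n (\<lambda>k. x k - s * y k)
    = disagreement n x - 2 * s * codisagreement n x y + s\<^sup>2 * disagreement n y"
proof -
  have "disagreement n (\<lambda>k. x k - s * y k)
      = (\<Sum>i<n. \<Sum>j<n. (x i - x j)\<^sup>2 - 2 * s * ((x i - x j) * (y i - y j)) + s\<^sup>2 * (y i - y j)\<^sup>2)"
    unfolding disagreement_def by (intro sum.cong refl) (simp add: power2_eq_square algebra_simps)
  then show ?thesis
    by (simp add: disagreement_def codisagreement_def sum.distrib sum_subtractf sum_distrib_left)
qed

text \<open>
With \<open>s = a + b + c\<close>, the difference of the two sides is the sum with weights \<open>p\<close>, \<open>q\<close>, \<open>r\<close> of
\<open>(a / p - s)\<^sup>2\<close>, \<open>(b / q - s)\<^sup>2\<close> and \<open>(c / r - s)\<^sup>2\<close>.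
\<close>

lemma convex_square_split:
  fixes a b c :: real
  assumes "0 < p" "0 < q" "0 < r" "p + q + r = 1"
  shows "(a + b + c)\<^sup>2 \<le> a\<^sup>2 / p + b\<^sup>2 / q + c\<^sup>2 / r"
proof -
  define s where "s = a + b + c"
  have eq: "y * (x / y - s)\<^sup>2 = x\<^sup>2 / y - 2 * s * x + y * s\<^sup>2" if "0 < y" for x y
    using that by (simp add: field_simps power2_eq_square)
  have "0 \<le> p * (a / p - s)\<^sup>2 + q * (b / q - s)\<^sup>2 + r * (c / r - s)\<^sup>2"
    using assms by simp
  also have "\<dots> = a\<^sup>2 / p + b\<^sup>2 / q + c\<^sup>2 / r - 2 * s * (a + b + c) + (p + q + r) * s\<^sup>2"
    using eq[of p a] eq[of q b] eq[of r c] assms(1-3) by (simp only: distrib_left distrib_right)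
  also have "\<dots> = a\<^sup>2 / p + b\<^sup>2 / q + c\<^sup>2 / r - s\<^sup>2"
    unfolding assms(4) s_def[symmetric] by (simp add: power2_eq_square)
  finally show ?thesis by (simp add: s_def)
qed

lemma disagreement_convex_split:
  assumes "0 < p" "0 < q" "0 < r" "p + q + r = 1"
  shows "disagreement n (\<lambda>k. x k + y k + z k)
    \<le> disagreement n x / p + disagreement n y / q + disagreement n z / r"
proof -
  have "disagreement n (\<lambda>k. x k + y k + z k)
      \<le> (\<Sum>i<n. \<Sum>j<n. (x i - x j)\<^sup>2 / p + (y i - y j)\<^sup>2 / q + (z i - z j)\<^sup>2 / r)"
    unfolding disagreement_def
  proof (intro sum_mono)
    fix i j
    show "(x i + y i + z i - (x j + y j + z j))\<^sup>2
        \<le> (x i - x j)\<^sup>2 / p + (y i - y j)\<^sup>2 / q + (z i - z j)\<^sup>2 / r"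
      using convex_square_split[OF assms, of "x i - x j" "y i - y j" "z i - z j"]
      by (simp add: algebra_simps)
  qed
  also have "\<dots> = disagreement n x / p + disagreement n y / q + disagreement n z / r"
    by (simp add: disagreement_def sum.distrib sum_divide_distrib)
  finally show ?thesis .
qed

section \<open>Orthogonal diagonalization of real symmetric matrices\<close>

no_notation inner (infix "\<bullet>" 70)

text \<open>
The reflection \<open>U\<close> along \<open>w = e\<^sub>0 - v\<close> exchanges \<open>e\<^sub>0\<close> and \<open>v\<close>. Being symmetric and its own
inverse, it is a convenient orthogonal change of basis with prescribed first basis vector. If
\<open>v = e\<^sub>0\<close>, then \<open>c = 2 / 0 = 0\<close> and \<open>U\<close> is the identity, as it should be.
\<close>

lemma householder_reflection:
  fixes v :: "real vec"
  assumes v: "v \<in> carrier_vec n" and n: "0 < n" and unit: "v \<bullet> v = 1"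
  shows "\<exists>U \<in> carrier_mat n n. transpose_mat U = U \<and> U * U = 1\<^sub>m n \<and> U *\<^sub>v unit_vec n 0 = v"
proof -
  define w where "w i = (if i = 0 then 1 else 0) - v $ i" for i
  define W where "W = (\<Sum>i<n. w i * w i)"
  define c where "c = 2 / W"
  define U where "U = mat n n (\<lambda>(i, j). (if i = j then 1 else 0) - c * w i * w j)"
  have U: "U \<in> carrier_mat n n" by (simp add: U_def)
  have vv: "(\<Sum>i<n. v $ i * v $ i) = 1"
    using unit v by (simp add: scalar_prod_def lessThan_atLeast0)
  have "W = (\<Sum>i<n. (if i = 0 then 1 - 2 * v $ 0 else 0) + v $ i * v $ i)"
    unfolding W_def by (rule sum.cong) (auto simp: w_def algebra_simps)
  then have W: "W = 2 * w 0"
    using n vv by (simp add: sum.distrib w_def)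
  have cW: "c * c * W = 2 * c" by (simp add: c_def)
  have "U * U = 1\<^sub>m n"
  proof (rule eq_matI)
    fix i j assume "i < dim_row (1\<^sub>m n :: real mat)" "j < dim_col (1\<^sub>m n :: real mat)"
    then have ij: "i < n" "j < n" by auto
    have "(U * U) $$ (i, j) = (\<Sum>k<n. U $$ (i, k) * U $$ (k, j))"
      using U ij by (simp add: scalar_prod_def lessThan_atLeast0)
    also have "\<dots> = (\<Sum>k<n. (if k = i then (if i = j then 1 else 0) - c * w i * w j else 0)
        - (if k = j then c * w i * w j else 0) + c * c * w i * w j * (w k * w k))"
      using ij by (intro sum.cong) (auto simp: U_def algebra_simps)
    also have "\<dots> = (if i = j then 1 else 0) - 2 * c * w i * w j + c * c * w i * w j * W"
      using ij by (simp add: sum.distrib sum_subtractf W_def sum_distrib_left)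
    also have "\<dots> = (if i = j then 1 else 0) - 2 * c * w i * w j + c * c * W * (w i * w j)"
      by (simp add: ac_simps)
    also have "\<dots> = (if i = j then 1 else 0)" by (simp add: cW)
    finally show "(U * U) $$ (i, j) = 1\<^sub>m n $$ (i, j)" using ij by simp
  qed (use U in auto)
  moreover have "transpose_mat U = U"
    by (rule eq_matI) (auto simp: U_def)
  moreover have "U *\<^sub>v unit_vec n 0 = v"
  proof (rule eq_vecI)
    fix i assume "i < dim_vec v"
    then have i: "i < n" using v by simp
    have eq: "(U *\<^sub>v unit_vec n 0) $ i = (if i = 0 then 1 else 0) - c * w 0 * w i"
      using U i n by (simp add: U_def)
    have "c * w 0 * w i = w i"
    proof (cases "W = 0")
      case True
      then have "w i = 0"
        using i unfolding W_def by (subst (asm) sum_nonneg_eq_0_iff) auto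
      then show ?thesis by simp
    next
      case False
      then show ?thesis by (simp add: c_def W)
    qed
    then show "(U *\<^sub>v unit_vec n 0) $ i = v $ i" unfolding eq by (simp only: w_def)
  qed (use U v in auto)
  ultimately show ?thesis using U by blast
qed

lemma unit_eigenvector:
  fixes A :: "real mat"
  assumes A: "A \<in> carrier_mat n n" and root: "poly (char_poly A) e = 0"
  obtains v where "v \<in> carrier_vec n" "v \<bullet> v = 1" "A *\<^sub>v v = e \<cdot>\<^sub>v v"
proof -
  from root obtain u where u: "u \<in> carrier_vec n" "u \<noteq> 0\<^sub>v n" "A *\<^sub>v u = e \<cdot>\<^sub>v u"
    using A unfolding eigenvalue_root_char_poly[OF A, symmetric] eigenvalue_def eigenvector_def by auto
  define s where "s = sqrt (u \<bullet> u)"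
  have "u \<bullet> u = (\<Sum>i<n. u $ i * u $ i)"
    using u by (simp add: scalar_prod_def lessThan_atLeast0)
  moreover obtain i where "i < n" "u $ i \<noteq> 0"
    using u by (metis eq_vecI carrier_vecD index_zero_vec)
  ultimately have pos: "u \<bullet> u > 0"
    by (auto intro!: sum_pos2[of _ i] simp: zero_less_mult_iff)
  then have s: "s \<noteq> 0" "s * s = u \<bullet> u" by (auto simp: s_def)
  show ?thesis
  proof (rule that[of "(1 / s) \<cdot>\<^sub>v u"])
    show "((1 / s) \<cdot>\<^sub>v u) \<bullet> ((1 / s) \<cdot>\<^sub>v u) = 1"
      using u s pos by (simp flip: s(2))
    show "A *\<^sub>v ((1 / s) \<cdot>\<^sub>v u) = e \<cdot>\<^sub>v ((1 / s) \<cdot>\<^sub>v u)"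
      using u A by (simp add: mult_mat_vec smult_smult_assoc mult.commute)
  qed (use u in auto)
qed

text \<open>
Deflation: conjugating by a reflection that moves \<open>e\<^sub>0\<close> to a unit eigenvector clears the first
column below the diagonal, and by symmetry also the first row. The remaining block is symmetric and
has the remaining factors as its characteristic polynomial. The given order of the roots is kept, so
that the columns of \<open>P\<close> can be matched with ordered eigenvalues.
\<close>

theorem real_symmetric_diagonalization:
  fixes A :: "real mat"
  assumes "A \<in> carrier_mat n n" and "transpose_mat A = A"
    and "char_poly A = (\<Prod>e\<leftarrow>es. [:- e, 1:])"
  shows "\<exists>P \<in> carrier_mat n n. transpose_mat P * P = 1\<^sub>m n \<and> A * P = P * mat_diag n ((!) es)"
  using assms
proof (induction es arbitrary: A n)
  case Nil
  then have "n = 0" using degree_monic_char_poly[of A n] by auto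
  then show ?case using Nil by (intro bexI[of _ "1\<^sub>m 0"]) (auto simp: mat_diag_def)
next
  case (Cons e es)
  have A: "A \<in> carrier_mat n n" and sym: "transpose_mat A = A" by fact+
  have cp: "char_poly A = [:- e, 1:] * (\<Prod>e\<leftarrow>es. [:- e, 1:])" using Cons.prems by simp
  have "monic (\<Prod>e\<leftarrow>es. [:- e, 1:] :: real poly)" by (rule monic_prod_list) auto
  then have "degree (char_poly A) = Suc (degree (\<Prod>e\<leftarrow>es. [:- e, 1:] :: real poly))"
    unfolding cp by (subst degree_mult_eq) auto
  with degree_monic_char_poly[OF A] have n0: "0 < n" by auto
  then obtain m where n: "n = Suc m" by (cases n) auto
  have "poly (char_poly A) e = 0" by (simp add: cp)
  then obtain v where v: "v \<in> carrier_vec n" "v \<bullet> v = 1" "A *\<^sub>v v = e \<cdot>\<^sub>v v"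
    using unit_eigenvector[OF A] by blast
  obtain U where U: "U \<in> carrier_mat n n" and Ut: "transpose_mat U = U"
    and UU: "U * U = 1\<^sub>m n" and Ue: "U *\<^sub>v unit_vec n 0 = v"
    using householder_reflection[OF v(1) n0 v(2)] by blast
  define A' where "A' = U * (A * U)"
  have A': "A' \<in> carrier_mat n n" using A U by (simp add: A'_def)
  have A'sym: "transpose_mat A' = A'"
    using A U by (simp add: A'_def transpose_mult[OF U, of _ n] transpose_mult[OF A U] sym Ut
        assoc_mult_mat[OF U A U])
  have Uv: "U *\<^sub>v v = unit_vec n 0"
  proof -
    have "U *\<^sub>v v = (U * U) *\<^sub>v unit_vec n 0" using U by (simp add: Ue[symmetric])
    then show ?thesis by (simp add: UU)
  qed
  have "A' *\<^sub>v unit_vec n 0 = U *\<^sub>v (A *\<^sub>v (U *\<^sub>v unit_vec n 0))"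
    using A U by (simp add: A'_def assoc_mult_mat_vec[of _ n n _ n])
  also have "\<dots> = e \<cdot>\<^sub>v unit_vec n 0"
    using U v by (simp add: Ue mult_mat_vec Uv)
  finally have A'e: "A' *\<^sub>v unit_vec n 0 = e \<cdot>\<^sub>v unit_vec n 0" .
  have col: "A' $$ (i, 0) = (if i = 0 then e else 0)" if "i < n" for i
    using arg_cong[OF A'e, of "\<lambda>u. u $ i"] A' that n0 by (simp split: if_splits)
  have row: "A' $$ (0, i) = (if i = 0 then e else 0)" if "i < n" for i
    using col[OF that] A' A'sym that n0 by (metis carrier_matD index_transpose_mat(1))
  define B where "B = mat m m (\<lambda>(i, j). A' $$ (Suc i, Suc j))"
  have B: "B \<in> carrier_mat m m" by (simp add: B_def)
  have A'B: "A' = four_block_mat (mat 1 1 (\<lambda>_. e)) (0\<^sub>m 1 m) (0\<^sub>m m 1) B"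
    using A' by (intro eq_matI) (auto simp: n B_def col row four_block_mat_def Let_def)
  have Bsym: "transpose_mat B = B"
  proof (rule eq_matI)
    fix i j assume "i < dim_row B" "j < dim_col B"
    then have ij: "Suc i < n" "Suc j < n" using B n by auto
    then have "A' $$ (Suc i, Suc j) = A' $$ (Suc j, Suc i)"
      using A' A'sym by (metis carrier_matD index_transpose_mat(1))
    then show "transpose_mat B $$ (i, j) = B $$ (i, j)" using ij n by (simp add: B_def)
  qed (use B in auto)
  have "similar_mat A' A"
    unfolding similar_mat_def
    by (intro exI[of _ U] similar_mat_witI[of _ _ n]) (use A U A' UU in \<open>auto simp: A'_def\<close>)
  then have "char_poly A' = [:- e, 1:] * (\<Prod>e\<leftarrow>es. [:- e, 1:])"
    using char_poly_similar cp by metis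
  moreover have "char_poly A' = char_poly (mat 1 1 (\<lambda>_. e)) * char_poly B"
    unfolding A'B using B by (intro char_poly_four_block_zeros_col) auto
  moreover have "char_poly (mat 1 1 (\<lambda>_. e)) = [:- e, 1:]"
    by (simp add: char_poly_defs det_def sign_def)
  ultimately have "char_poly B = (\<Prod>e\<leftarrow>es. [:- e, 1:])"
    by (metis mult_cancel_left pCons_eq_0_iff zero_neq_one)
  from Cons.IH[OF B Bsym this] obtain Q where Q: "Q \<in> carrier_mat m m"
    and QQ: "transpose_mat Q * Q = 1\<^sub>m m" and BQ: "B * Q = Q * mat_diag m ((!) es)" by blast
  define F where "F = four_block_mat (1\<^sub>m 1) (0\<^sub>m 1 m) (0\<^sub>m m 1) Q"
  have F: "F \<in> carrier_mat n n" using Q by (auto simp: F_def n)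
  have D: "mat_diag n ((!) (e # es)) =
      four_block_mat (mat 1 1 (\<lambda>_. e)) (0\<^sub>m 1 m) (0\<^sub>m m 1) (mat_diag m ((!) es))"
    by (intro eq_matI) (auto simp: n mat_diag_def four_block_mat_def Let_def nth_Cons')
  have FF: "transpose_mat F * F = 1\<^sub>m n"
  proof -
    have "transpose_mat F = four_block_mat (1\<^sub>m 1) (0\<^sub>m 1 m) (0\<^sub>m m 1) (transpose_mat Q)"
      using Q by (simp add: F_def transpose_four_block_mat[where ?nr1.0 = 1 and ?nc1.0 = 1 and ?nr2.0 = m and ?nc2.0 = m])
    moreover have "\<dots> * F = four_block_mat (1\<^sub>m 1) (0\<^sub>m 1 m) (0\<^sub>m m 1) (1\<^sub>m m)"
      using Q QQ unfolding F_def by (subst mult_four_block_mat[of _ 1 1 _ m _ m]) auto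
    ultimately show ?thesis by (simp add: n four_block_one_mat)
  qed
  have AF: "A' * F = F * mat_diag n ((!) (e # es))"
    unfolding A'B F_def D using Q B BQ left_mult_zero_mat[OF mat_diag_dim, of "Suc 0" m "(!) es"]
    by (subst (1 2) mult_four_block_mat[of _ 1 1 _ m _ m]) auto
  show ?case
  proof (intro bexI conjI)
    show "U * F \<in> carrier_mat n n" using U F by simp
    have "transpose_mat (U * F) * (U * F) = transpose_mat F * ((U * U) * F)"
      using U F by (simp add: transpose_mult[OF U F] Ut assoc_mult_mat[of _ n n _ n _ n])
    then show "transpose_mat (U * F) * (U * F) = 1\<^sub>m n" using F FF by (simp add: UU)
    have "A * (U * F) = (U * U) * (A * (U * F))" using A U F by (simp add: UU)
    also have "\<dots> = U * (A' * F)"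
      using A U F by (simp add: A'_def assoc_mult_mat[of _ n n _ n _ n])
    also have "\<dots> = (U * F) * mat_diag n ((!) (e # es))"
      using U F by (simp add: AF assoc_mult_mat[of _ n n _ n _ n])
    finally show "A * (U * F) = (U * F) * mat_diag n ((!) (e # es))" .
  qed
qed

section \<open>Spectral bounds for graph Laplacians\<close>

definition mat_app :: "real mat \<Rightarrow> nat \<Rightarrow> (nat \<Rightarrow> real) \<Rightarrow> nat \<Rightarrow> real" where
  "mat_app L n x i = (\<Sum>j<n. L $$ (i, j) * x j)"

text \<open>
Laplacians of weighted graphs with nonnegative weights, a class closed under sums and under
Kronecker products with identity matrices.
\<close>

definition graph_laplacian :: "nat \<Rightarrow> real mat \<Rightarrow> bool" where
  "graph_laplacian n L \<longleftrightarrow> L \<in> carrier_mat n n \<and>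
     (\<forall>i<n. \<forall>j<n. L $$ (i, j) = L $$ (j, i)) \<and>
     (\<forall>i<n. \<forall>j<n. i \<noteq> j \<longrightarrow> L $$ (i, j) \<le> 0) \<and>
     (\<forall>i<n. (\<Sum>j<n. L $$ (i, j)) = 0)"

text \<open>
Twice the quadratic form is the sum of \<open>- L\<^sub>i\<^sub>j (x\<^sub>i - x\<^sub>j)\<^sup>2\<close>, in which the diagonal does not
contribute and all other coefficients are nonnegative.
\<close>

lemma graph_laplacian_quadratic_form_nonneg:
  assumes L: "graph_laplacian n L"
  shows "0 \<le> (\<Sum>i<n. x i * mat_app L n x i)"
proof -
  have sym: "\<And>i j. i < n \<Longrightarrow> j < n \<Longrightarrow> L $$ (i, j) = L $$ (j, i)"
    and off: "\<And>i j. i < n \<Longrightarrow> j < n \<Longrightarrow> i \<noteq> j \<Longrightarrow> L $$ (i, j) \<le> 0"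
    and row: "\<And>i. i < n \<Longrightarrow> (\<Sum>j<n. L $$ (i, j)) = 0"
    using L by (auto simp: graph_laplacian_def)
  have row': "(\<Sum>i<n. L $$ (i, j)) = 0" if "j < n" for j
  proof -
    have "(\<Sum>i<n. L $$ (i, j)) = (\<Sum>i<n. L $$ (j, i))"
      using sym that by (intro sum.cong) auto
    then show ?thesis using row[OF that] by simp
  qed
  have "0 \<le> (\<Sum>i<n. \<Sum>j<n. - L $$ (i, j) * (x i - x j)\<^sup>2)"
  proof (intro sum_nonneg)
    fix i j assume "i \<in> {..<n}" "j \<in> {..<n}"
    then show "0 \<le> - L $$ (i, j) * (x i - x j)\<^sup>2"
      using off[of i j] by (cases "i = j") (auto simp: mult_nonpos_nonneg)
  qed
  also have "\<dots> = (\<Sum>i<n. \<Sum>j<n. 2 * (x i * (L $$ (i, j) * x j)) - (x i)\<^sup>2 * L $$ (i, j) - L $$ (i, j) * (x j)\<^sup>2)"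
    by (intro sum.cong refl) (simp add: power2_diff algebra_simps power2_eq_square)
  also have "\<dots> = 2 * (\<Sum>i<n. x i * mat_app L n x i)
      - (\<Sum>i<n. (x i)\<^sup>2 * (\<Sum>j<n. L $$ (i, j))) - (\<Sum>i<n. \<Sum>j<n. L $$ (i, j) * (x j)\<^sup>2)"
    by (simp add: sum_subtractf sum_distrib_left mat_app_def)
  also have "(\<Sum>i<n. (x i)\<^sup>2 * (\<Sum>j<n. L $$ (i, j))) = 0" using row by simp
  also have "(\<Sum>i<n. \<Sum>j<n. L $$ (i, j) * (x j)\<^sup>2) = 0"
    by (subst sum.swap) (simp add: sum_distrib_right[symmetric] row')
  finally show ?thesis by simp
qed

text \<open>
In an orthonormal eigenbasis the left-hand side weights the squared coordinates of \<open>x\<close> by a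
function of the eigenvalues that is at most \<open>m\<close> for all indices but the first. Since \<open>L\<close> is
positive semidefinite and annihilates the constant vector, the first eigenvalue is \<open>0\<close>. Either the
second one is \<open>0\<close> as well, and the bound extends to the first index, or the kernel is spanned by
the constant vector, and the first coordinate of the mean-zero vector \<open>x\<close> vanishes.
\<close>

lemma mean_zero_spectral_bound:
  fixes L :: "real mat"
  assumes L: "graph_laplacian n L" and n: "2 \<le> n"
    and lam: "ordered_eigenvalues L n lam"
    and bound: "\<And>i. i \<in> {2..n} \<Longrightarrow> (b - c * lam i)\<^sup>2 + s * (lam i)\<^sup>2 \<le> m"
    and mean: "(\<Sum>i<n. x i) = 0"
  shows "(\<Sum>i<n. (b * x i - c * mat_app L n x i)\<^sup>2) + s * (\<Sum>i<n. (mat_app L n x i)\<^sup>2)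
    \<le> m * (\<Sum>i<n. (x i)\<^sup>2)"
proof -
  have carrier: "L \<in> carrier_mat n n"
    and sym: "\<And>i j. i < n \<Longrightarrow> j < n \<Longrightarrow> L $$ (i, j) = L $$ (j, i)"
    and row: "\<And>i. i < n \<Longrightarrow> (\<Sum>j<n. L $$ (i, j)) = 0"
    using L by (auto simp: graph_laplacian_def)
  have T: "transpose_mat L = L"
    using carrier sym by (intro eq_matI) auto
  define es where "es = map (\<lambda>i. lam (Suc i)) [0..<n]"
  have "(\<Prod>e\<leftarrow>es. [:- e, 1:]) = (\<Prod>i<n. [:- lam (Suc i), 1:])"
    by (simp add: es_def o_def prod.list_conv_set_nth lessThan_atLeast0)
  also have "\<dots> = (\<Prod>i = 1..n. [:- lam i, 1:])"
    by (rule prod.reindex_bij_witness[of _ "\<lambda>i. i - 1" Suc]) auto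
  finally have "char_poly L = (\<Prod>e\<leftarrow>es. [:- e, 1:])"
    using lam by (simp add: ordered_eigenvalues_def)
  from real_symmetric_diagonalization[OF carrier T this]
  obtain P where P: "P \<in> carrier_mat n n" and PP: "transpose_mat P * P = 1\<^sub>m n"
    and LP: "L * P = P * mat_diag n ((!) es)" by blast
  have PP': "P * transpose_mat P = 1\<^sub>m n"
    using P PP by (intro mat_mult_left_right_inverse[of "transpose_mat P"]) auto
  (* h y is the coordinate vector of y with respect to the columns of P. *)
  define h where "h y i = (\<Sum>j<n. P $$ (j, i) * y j)" for y :: "nat \<Rightarrow> real" and i
  have orth: "(\<Sum>k<n. P $$ (i, k) * P $$ (j, k)) = (if i = j then 1 else 0)" if "i < n" "j < n" for i j
    using arg_cong[OF PP', of "\<lambda>M. M $$ (i, j)"] P that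
    by (simp add: scalar_prod_def lessThan_atLeast0)
  have orth': "(\<Sum>k<n. P $$ (k, i) * P $$ (k, j)) = (if i = j then 1 else 0)" if "i < n" "j < n" for i j
    using arg_cong[OF PP, of "\<lambda>M. M $$ (i, j)"] P that
    by (simp add: scalar_prod_def lessThan_atLeast0)
  have eig: "(\<Sum>k<n. L $$ (i, k) * P $$ (k, j)) = lam (Suc j) * P $$ (i, j)" if "i < n" "j < n" for i j
  proof -
    have "(P * mat_diag n ((!) es)) $$ (i, j) = (\<Sum>k<n. if k = j then P $$ (i, k) * es ! k else 0)"
      using P that by (simp add: scalar_prod_def lessThan_atLeast0 mat_diag_def if_distrib cong: if_cong)
    then show ?thesis
      using arg_cong[OF LP, of "\<lambda>M. M $$ (i, j)"] P carrier that
      by (simp add: scalar_prod_def lessThan_atLeast0 es_def)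
  qed
  have parseval: "(\<Sum>i<n. h y i * h z i) = (\<Sum>i<n. y i * z i)" for y z
  proof -
    have "(\<Sum>i<n. h y i * h z i) = (\<Sum>i<n. \<Sum>j<n. \<Sum>k<n. (P $$ (j, i) * P $$ (k, i)) * (y j * z k))"
      by (simp add: h_def sum_product ac_simps)
    also have "\<dots> = (\<Sum>j<n. \<Sum>k<n. \<Sum>i<n. (P $$ (j, i) * P $$ (k, i)) * (y j * z k))"
      by (subst sum.swap, rule sum.cong[OF refl], rule sum.swap)
    also have "\<dots> = (\<Sum>j<n. \<Sum>k<n. (if j = k then 1 else 0) * (y j * z k))"
      by (intro sum.cong refl) (simp add: sum_distrib_right[symmetric] orth del: of_bool_def)
    also have "\<dots> = (\<Sum>j<n. y j * z j)"
      by (intro sum.cong refl) (simp add: if_distrib[of "\<lambda>u. u * _"] cong: if_cong)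
    finally show ?thesis .
  qed
  have hL: "h (mat_app L n y) i = lam (Suc i) * h y i" if i: "i < n" for y i
  proof -
    have "h (mat_app L n y) i = (\<Sum>j<n. \<Sum>k<n. P $$ (j, i) * (L $$ (j, k) * y k))"
      by (simp add: h_def mat_app_def sum_distrib_left)
    also have "\<dots> = (\<Sum>k<n. \<Sum>j<n. P $$ (j, i) * (L $$ (j, k) * y k))" by (rule sum.swap)
    also have "\<dots> = (\<Sum>k<n. \<Sum>j<n. (L $$ (k, j) * P $$ (j, i)) * y k)"
      by (intro sum.cong refl) (simp add: sym)
    also have "\<dots> = (\<Sum>k<n. (\<Sum>j<n. L $$ (k, j) * P $$ (j, i)) * y k)"
      by (simp add: sum_distrib_right)
    also have "\<dots> = lam (Suc i) * h y i"
      using i by (simp add: eig h_def sum_distrib_left ac_simps)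
    finally show ?thesis .
  qed
  have mono: "lam i \<le> lam j" if "1 \<le> i" "i \<le> j" "j \<le> n" for i j
    using lam that by (auto simp: ordered_eigenvalues_def mono_on_def)
  have nonneg: "0 \<le> lam (Suc j)" if j: "j < n" for j
  proof -
    have "(\<Sum>i<n. P $$ (i, j) * mat_app L n (\<lambda>i. P $$ (i, j)) i)
        = lam (Suc j) * (\<Sum>i<n. P $$ (i, j) * P $$ (i, j))"
      using j by (simp add: mat_app_def eig sum_distrib_left ac_simps)
    then show ?thesis
      using graph_laplacian_quadratic_form_nonneg[OF L, of "\<lambda>i. P $$ (i, j)"] orth'[OF j j] by simp
  qed
  (* Coordinates of the constant vector; they live on the kernel of L. *)
  define u where "u = h (\<lambda>_. 1)"
  have lam_u: "lam (Suc i) * u i = 0" if "i < n" for i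
  proof -
    have "h (mat_app L n (\<lambda>_. 1)) i = 0" by (simp add: h_def mat_app_def row)
    then show ?thesis using hL[OF that, of "\<lambda>_. 1"] by (simp add: u_def)
  qed
  have u_sq: "(\<Sum>i<n. u i * u i) = real n" by (simp add: u_def parseval)
  have "\<exists>j<n. u j \<noteq> 0"
  proof (rule ccontr)
    assume "\<not> ?thesis"
    then have "(\<Sum>i<n. u i * u i) = 0" by simp
    then show False using u_sq n by simp
  qed
  then obtain j where j: "j < n" "u j \<noteq> 0" by blast
  then have "lam (Suc j) = 0" using lam_u by auto
  then have lam1: "lam 1 = 0" using mono[of 1 "Suc j"] nonneg[of 0] j n by simp
  define q where "q i = (b - c * lam (Suc i))\<^sup>2 + s * (lam (Suc i))\<^sup>2" for i
  have q: "q i * (h x i)\<^sup>2 \<le> m * (h x i)\<^sup>2" if i: "i < n" for i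
  proof (cases "i = 0")
    case False
    then show ?thesis using bound[of "Suc i"] i by (intro mult_right_mono) (auto simp: q_def)
  next
    case True
    show ?thesis
    proof (cases "lam 2 = 0")
      case True
      then show ?thesis using bound[of 2] n lam1 \<open>i = 0\<close> by (intro mult_right_mono) (auto simp: q_def)
    next
      case False
      have u0: "u k = 0" if "k < n" "k \<noteq> 0" for k
      proof -
        have "0 < lam (Suc k)"
          using False nonneg[of 1] mono[of 2 "Suc k"] that n by (simp add: numeral_2_eq_2)
        then show ?thesis using lam_u that by fastforce
      qed
      have "(\<Sum>k<n. h x k * u k) = (\<Sum>k<n. if k = 0 then h x 0 * u 0 else 0)"
        using u0 by (intro sum.cong) auto
      then have "h x 0 * u 0 = 0"
        using mean n by (simp add: u_def parseval)
      moreover have "u 0 \<noteq> 0" using j u0 by metis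
      ultimately show ?thesis using \<open>i = 0\<close> by simp
    qed
  qed
  have hlin: "h (\<lambda>i. b * x i - c * mat_app L n x i) i = (b - c * lam (Suc i)) * h x i" if "i < n" for i
  proof -
    have "h (\<lambda>i. b * x i - c * mat_app L n x i) i = b * h x i - c * h (mat_app L n x) i"
      by (simp add: h_def sum_subtractf sum_distrib_left algebra_simps)
    then show ?thesis by (simp add: hL that algebra_simps)
  qed
  have parseval_sq: "(\<Sum>i<n. (y i)\<^sup>2) = (\<Sum>i<n. (h y i)\<^sup>2)" for y
    using parseval[of y y] by (simp add: power2_eq_square)
  have "(\<Sum>i<n. (b * x i - c * mat_app L n x i)\<^sup>2) + s * (\<Sum>i<n. (mat_app L n x i)\<^sup>2)
    = (\<Sum>i<n. ((b - c * lam (Suc i)) * h x i)\<^sup>2) + s * (\<Sum>i<n. (lam (Suc i) * h x i)\<^sup>2)"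
    unfolding parseval_sq[of "\<lambda>i. b * x i - c * mat_app L n x i"] parseval_sq[of "mat_app L n x"]
    by (simp add: hlin hL)
  also have "\<dots> = (\<Sum>i<n. q i * (h x i)\<^sup>2)"
    by (simp add: q_def sum.distrib sum_distrib_left distrib_right power_mult_distrib mult.assoc)
  also have "\<dots> \<le> (\<Sum>i<n. m * (h x i)\<^sup>2)" using q by (intro sum_mono) auto
  also have "\<dots> = m * (\<Sum>i<n. (x i)\<^sup>2)"
    by (simp add: parseval_sq[of x] sum_distrib_left)
  finally show ?thesis .
qed

text \<open>
Disagreement and Laplacian do not see a constant shift, so \<open>x\<close> may be centred first. The image of
\<open>L\<close> has mean zero by symmetry.
\<close>

lemma disagreement_spectral_bound:
  fixes L :: "real mat"
  assumes L: "graph_laplacian n L" and n: "2 \<le> n"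
    and lam: "ordered_eigenvalues L n lam"
    and bound: "\<And>i. i \<in> {2..n} \<Longrightarrow> (b - c * lam i)\<^sup>2 + s * (lam i)\<^sup>2 \<le> m"
  shows "disagreement n (\<lambda>i. b * x i - c * mat_app L n x i) + s * disagreement n (mat_app L n x)
    \<le> m * disagreement n x"
proof -
  have sym: "\<And>i j. i < n \<Longrightarrow> j < n \<Longrightarrow> L $$ (i, j) = L $$ (j, i)"
    and row: "\<And>i. i < n \<Longrightarrow> (\<Sum>j<n. L $$ (i, j)) = 0"
    using L by (auto simp: graph_laplacian_def)
  define r where "r = (\<Sum>i<n. x i) / real n"
  define e where "e i = x i - r" for i
  have mean: "(\<Sum>i<n. e i) = 0" using n by (simp add: e_def r_def sum_subtractf)
  have shift: "mat_app L n x i = mat_app L n e i" if "i < n" for i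
    using row[OF that] by (simp add: mat_app_def e_def algebra_simps sum_subtractf sum_distrib_left[symmetric])
  have "(\<Sum>i<n. mat_app L n e i) = (\<Sum>j<n. \<Sum>i<n. L $$ (i, j) * e j)"
    unfolding mat_app_def by (rule sum.swap)
  also have "\<dots> = (\<Sum>j<n. (\<Sum>i<n. L $$ (j, i)) * e j)"
    using sym by (auto simp: sum_distrib_right intro!: sum.cong)
  finally have meanL: "(\<Sum>i<n. mat_app L n e i) = 0" by (simp add: row)
  have x: "disagreement n x = disagreement n e"
    by (simp add: disagreement_def e_def)
  have A: "disagreement n (\<lambda>i. b * x i - c * mat_app L n x i) = disagreement n (\<lambda>i. b * e i - c * mat_app L n e i)"
    unfolding disagreement_def by (intro sum.cong refl) (simp add: shift e_def algebra_simps)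
  have B: "disagreement n (mat_app L n x) = disagreement n (mat_app L n e)"
    unfolding disagreement_def by (intro sum.cong refl) (simp add: shift)
  have "(\<Sum>i<n. b * e i - c * mat_app L n e i) = 0"
    by (simp add: sum_subtractf sum_distrib_left[symmetric] mean meanL)
  then show ?thesis
    unfolding x A B unfolding disagreement_eq_variance
    using mult_left_mono[OF mean_zero_spectral_bound[OF L n lam bound mean], of "2 * real n"]
    by (simp add: mean meanL algebra_simps)
qed

section \<open>The torus Laplacian is a graph Laplacian\<close>

lemma int_ring_dist:
  assumes "i < N" "j < N"
  shows "int (ring_dist N i j) = min ((int i - int j) mod int N) ((int j - int i) mod int N)"
proof -
  have "int ((a + N - b) mod N) = (int a - int b) mod int N" if "b < N" for a b
  proof -
    have "int (a + N - b) = int a - int b + int N" using that by simp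
    then show ?thesis by (simp add: zmod_int)
  qed
  then show ?thesis using assms by (simp add: ring_dist_def of_nat_min)
qed

text \<open>
Adjacency is defined by counting the agents closer to \<open>i\<close> than \<open>j\<close> is, and this is not visibly
symmetric. The reflection \<open>l \<mapsto> i + j - l\<close> of the ring exchanges \<open>i\<close> and \<open>j\<close>, preserves distances,
and so maps the agents counted for one direction onto those counted for the other.
\<close>

lemma ring_adj_sym:
  assumes i: "i < N" and j: "j < N"
  shows "ring_adj N k i j \<longleftrightarrow> ring_adj N k j i"
proof -
  define r where "r l = nat ((int i + int j - int l) mod int N)" for l
  define S where "S a b = {l. l < N \<and> l \<noteq> a \<and> ring_dist N a l < ring_dist N a b}" for a b
  have N: "0 < N" using i by simp
  have int_r: "int (r l) = (int i + int j - int l) mod int N" for l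
    using N by (simp add: r_def)
  have r_less: "r l < N" for l
  proof -
    have "int (r l) < int N" unfolding int_r using N by simp
    then show ?thesis by simp
  qed
  have rr: "r (r l) = l" if "l < N" for l
  proof -
    have "int (r (r l)) = int l mod int N"
      unfolding int_r[of "r l"] int_r[of l] by (simp add: mod_diff_right_eq)
    then show ?thesis using that by simp
  qed
  have ri: "r i = j" and rj: "r j = i"
    using i j by (auto simp: r_def)
  have dist_r: "ring_dist N (r a) (r b) = ring_dist N a b" if "a < N" "b < N" for a b
  proof -
    have "(int (r a) - int (r b)) mod int N = (int b - int a) mod int N" for a b
      unfolding int_r by (simp add: mod_diff_eq)
    then have "int (ring_dist N (r a) (r b)) = int (ring_dist N a b)"
      using that r_less by (simp add: int_ring_dist min.commute)
    then show ?thesis by simp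
  qed
  have S_r: "r l \<in> S (r a) (r b)" if "l \<in> S a b" "a < N" "b < N" for l a b
  proof -
    have l: "l < N" "l \<noteq> a" "ring_dist N a l < ring_dist N a b" using that by (auto simp: S_def)
    then have "r l \<noteq> r a" using rr that by metis
    then show ?thesis using l that r_less by (simp add: S_def dist_r)
  qed
  have "bij_betw r (S i j) (S j i)"
  proof (rule bij_betw_byWitness[where f' = r])
    show "\<forall>a\<in>S i j. r (r a) = a" "\<forall>a\<in>S j i. r (r a) = a" using rr by (auto simp: S_def)
    show "r ` S i j \<subseteq> S j i" using S_r[of _ i j] i j by (auto simp: ri rj)
    show "r ` S j i \<subseteq> S i j" using S_r[of _ j i] i j by (auto simp: ri rj)
  qed
  then have "card (S i j) = card (S j i)" by (rule bij_betw_same_card)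
  then show ?thesis unfolding ring_adj_def S_def by auto
qed

lemma graph_laplacian_ring: "graph_laplacian N (ring_laplacian N k)"
  unfolding graph_laplacian_def
proof (intro conjI allI impI)
  show "ring_laplacian N k \<in> carrier_mat N N" by (simp add: ring_laplacian_def)
  fix i assume i: "i < N"
  show "ring_laplacian N k $$ (i, j) = ring_laplacian N k $$ (j, i)" if "j < N" for j
    using i that ring_adj_sym[OF i that] by (auto simp: ring_laplacian_def)
  show "ring_laplacian N k $$ (i, j) \<le> 0" if "j < N" "i \<noteq> j" for j
    using i that by (simp add: ring_laplacian_def)
  define S where "S = {l. l < N \<and> ring_adj N k i l}"
  have S: "finite S" "S \<subseteq> {..<N}" "i \<notin> S" by (auto simp: S_def ring_adj_def)
  have "(\<Sum>j<N. ring_laplacian N k $$ (i, j))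
      = (\<Sum>j<N. (if j = i then real (card S) else 0) + (if j \<in> S then -1 else 0))"
    using i S by (intro sum.cong) (auto simp: ring_laplacian_def S_def)
  also have "\<dots> = real (card S) + (\<Sum>j\<in>S. -1)"
    using i S by (simp add: sum.distrib sum.inter_restrict[symmetric] Int_absorb1)
  finally show "(\<Sum>j<N. ring_laplacian N k $$ (i, j)) = 0" by simp
qed

text \<open>
Splitting an index into quotient and remainder factorizes the row sums of a Kronecker product.
\<close>

lemma sum_div_mod:
  fixes f g :: "nat \<Rightarrow> real"
  assumes m: "0 < m"
  shows "(\<Sum>j<p * m. f (j div m) * g (j mod m)) = (\<Sum>a<p. f a) * (\<Sum>b<m. g b)"
proof -
  have "(\<Sum>j<p * m. f (j div m) * g (j mod m)) = (\<Sum>(a, b)\<in>{..<p} \<times> {..<m}. f a * g b)"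
  proof (rule sum.reindex_bij_witness[of _ "\<lambda>(a, b). a * m + b" "\<lambda>j. (j div m, j mod m)"])
    fix c assume "c \<in> {..<p} \<times> {..<m}"
    then obtain a b where c: "c = (a, b)" "a < p" "b < m" by auto
    have "a * m + b < (a + 1) * m" using c by simp
    also have "\<dots> \<le> p * m" using c by (intro mult_right_mono) auto
    finally show "(case c of (a, b) \<Rightarrow> a * m + b) \<in> {..<p * m}" using c by simp
    show "((case c of (a, b) \<Rightarrow> a * m + b) div m, (case c of (a, b) \<Rightarrow> a * m + b) mod m) = c"
      using c by simp
  qed (use m in \<open>auto simp: less_mult_imp_div_less\<close>)
  then show ?thesis by (simp add: sum_product sum.cartesian_product)
qed

lemma graph_laplacian_kronecker_id_left:
  assumes L: "graph_laplacian m L"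
  shows "graph_laplacian (p * m) (kronecker (1\<^sub>m p) L)"
proof -
  have Lc: "L \<in> carrier_mat m m"
    and sym: "\<And>i j. i < m \<Longrightarrow> j < m \<Longrightarrow> L $$ (i, j) = L $$ (j, i)"
    and off: "\<And>i j. i < m \<Longrightarrow> j < m \<Longrightarrow> i \<noteq> j \<Longrightarrow> L $$ (i, j) \<le> 0"
    and row: "\<And>i. i < m \<Longrightarrow> (\<Sum>j<m. L $$ (i, j)) = 0"
    using L by (auto simp: graph_laplacian_def)
  have K: "kronecker (1\<^sub>m p) L $$ (i, j) = (if i div m = j div m then 1 else 0) * L $$ (i mod m, j mod m)"
    if "i < p * m" "j < p * m" for i j
    using that Lc by (simp add: kronecker_def less_mult_imp_div_less)
  show ?thesis
    unfolding graph_laplacian_def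
  proof (intro conjI allI impI)
    show "kronecker (1\<^sub>m p) L \<in> carrier_mat (p * m) (p * m)" using Lc by (simp add: kronecker_def)
    fix i assume i: "i < p * m"
    then have m: "0 < m" by (cases m) auto
    show "kronecker (1\<^sub>m p) L $$ (i, j) = kronecker (1\<^sub>m p) L $$ (j, i)" if "j < p * m" for j
      using i that m sym[of "i mod m" "j mod m"] by (auto simp: K)
    show "kronecker (1\<^sub>m p) L $$ (i, j) \<le> 0" if "j < p * m" "i \<noteq> j" for j
    proof (cases "i div m = j div m")
      case True
      then have "i mod m \<noteq> j mod m" using that by (metis div_mult_mod_eq)
      then show ?thesis using off[of "i mod m" "j mod m"] i that m by (simp add: K)
    qed (use i that in \<open>simp add: K\<close>)
    have "(\<Sum>j<p * m. kronecker (1\<^sub>m p) L $$ (i, j))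
        = (\<Sum>j<p * m. (\<lambda>a. if i div m = a then 1 else 0) (j div m) * (\<lambda>b. L $$ (i mod m, b)) (j mod m))"
      using i by (intro sum.cong) (auto simp: K)
    also have "\<dots> = (\<Sum>a<p. if i div m = a then 1 else 0) * (\<Sum>b<m. L $$ (i mod m, b))"
      by (rule sum_div_mod[OF m, of "\<lambda>a. if i div m = a then 1 else 0" "\<lambda>b. L $$ (i mod m, b)"])
    also have "\<dots> = 0" using row[of "i mod m"] m by simp
    finally show "(\<Sum>j<p * m. kronecker (1\<^sub>m p) L $$ (i, j)) = 0" .
  qed
qed

lemma graph_laplacian_kronecker_id_right:
  assumes L: "graph_laplacian m L"
  shows "graph_laplacian (m * q) (kronecker L (1\<^sub>m q))"
proof -
  have Lc: "L \<in> carrier_mat m m"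
    and sym: "\<And>i j. i < m \<Longrightarrow> j < m \<Longrightarrow> L $$ (i, j) = L $$ (j, i)"
    and off: "\<And>i j. i < m \<Longrightarrow> j < m \<Longrightarrow> i \<noteq> j \<Longrightarrow> L $$ (i, j) \<le> 0"
    and row: "\<And>i. i < m \<Longrightarrow> (\<Sum>j<m. L $$ (i, j)) = 0"
    using L by (auto simp: graph_laplacian_def)
  have K: "kronecker L (1\<^sub>m q) $$ (i, j) = L $$ (i div q, j div q) * (if i mod q = j mod q then 1 else 0)"
    if "i < m * q" "j < m * q" for i j
  proof -
    have "0 < q" using that by (cases q) auto
    then show ?thesis using that Lc by (simp add: kronecker_def)
  qed
  show ?thesis
    unfolding graph_laplacian_def
  proof (intro conjI allI impI)
    show "kronecker L (1\<^sub>m q) \<in> carrier_mat (m * q) (m * q)" using Lc by (simp add: kronecker_def)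
    fix i assume i: "i < m * q"
    then have q: "0 < q" by (cases q) auto
    have iq: "i div q < m" using i by (rule less_mult_imp_div_less)
    show "kronecker L (1\<^sub>m q) $$ (i, j) = kronecker L (1\<^sub>m q) $$ (j, i)" if "j < m * q" for j
      using i that sym[OF iq less_mult_imp_div_less[OF that]] by (auto simp: K)
    show "kronecker L (1\<^sub>m q) $$ (i, j) \<le> 0" if "j < m * q" "i \<noteq> j" for j
    proof (cases "i mod q = j mod q")
      case True
      then have "i div q \<noteq> j div q" using that by (metis div_mult_mod_eq)
      then show ?thesis using off[OF iq less_mult_imp_div_less[OF that(1)]] i that by (simp add: K)
    qed (use i that in \<open>simp add: K\<close>)
    have "(\<Sum>j<m * q. kronecker L (1\<^sub>m q) $$ (i, j))
        = (\<Sum>j<m * q. (\<lambda>a. L $$ (i div q, a)) (j div q) * (\<lambda>b. if i mod q = b then 1 else 0) (j mod q))"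
      using i by (intro sum.cong) (auto simp: K)
    also have "\<dots> = (\<Sum>a<m. L $$ (i div q, a)) * (\<Sum>b<q. if i mod q = b then 1 else 0)"
      by (rule sum_div_mod[OF q, of "\<lambda>a. L $$ (i div q, a)" "\<lambda>b. if i mod q = b then 1 else 0"])
    also have "\<dots> = 0" using row[OF iq] by simp
    finally show "(\<Sum>j<m * q. kronecker L (1\<^sub>m q) $$ (i, j)) = 0" .
  qed
qed

lemma graph_laplacian_sum:
  assumes "\<And>s. s < d \<Longrightarrow> graph_laplacian n (A s)"
  shows "graph_laplacian n (mat n n (\<lambda>rc. \<Sum>s<d. A s $$ rc))"
  unfolding graph_laplacian_def
proof (intro conjI allI impI)
  fix i assume i: "i < n"
  have A: "\<And>s i j. s < d \<Longrightarrow> i < n \<Longrightarrow> j < n \<Longrightarrow> A s $$ (i, j) = A s $$ (j, i)"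
    "\<And>s i j. s < d \<Longrightarrow> i < n \<Longrightarrow> j < n \<Longrightarrow> i \<noteq> j \<Longrightarrow> A s $$ (i, j) \<le> 0"
    "\<And>s i. s < d \<Longrightarrow> i < n \<Longrightarrow> (\<Sum>j<n. A s $$ (i, j)) = 0"
    using assms by (auto simp: graph_laplacian_def)
  show "mat n n (\<lambda>rc. \<Sum>s<d. A s $$ rc) $$ (i, j) = mat n n (\<lambda>rc. \<Sum>s<d. A s $$ rc) $$ (j, i)"
    if "j < n" for j
    using i that A(1)[of _ i j] by simp
  show "mat n n (\<lambda>rc. \<Sum>s<d. A s $$ rc) $$ (i, j) \<le> 0" if "j < n" "i \<noteq> j" for j
    using i that A(2)[of _ i j] by (auto intro: sum_nonpos)
  have "(\<Sum>j<n. mat n n (\<lambda>rc. \<Sum>s<d. A s $$ rc) $$ (i, j)) = (\<Sum>j<n. \<Sum>s<d. A s $$ (i, j))"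
    using i by simp
  also have "\<dots> = (\<Sum>s<d. \<Sum>j<n. A s $$ (i, j))" by (rule sum.swap)
  finally show "(\<Sum>j<n. mat n n (\<lambda>rc. \<Sum>s<d. A s $$ rc) $$ (i, j)) = 0" using i A(3) by simp
qed simp

lemma graph_laplacian_torus: "graph_laplacian (N ^ d) (torus_laplacian N k d)"
  unfolding torus_laplacian_def
proof (rule graph_laplacian_sum)
  fix s assume "s < d"
  then have "N ^ (d - 1 - s) * N * N ^ s = N ^ (Suc (d - 1 - s) + s)" by (simp only: power_add) simp
  also have "Suc (d - 1 - s) + s = d" using \<open>s < d\<close> by simp
  finally have "N ^ d = N ^ (d - 1 - s) * N * N ^ s" ..
  then show "graph_laplacian (N ^ d)
      (kronecker (kronecker (1\<^sub>m (N ^ (d - 1 - s))) (ring_laplacian N k)) (1\<^sub>m (N ^ s)))"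
    by (simp only: graph_laplacian_kronecker_id_right graph_laplacian_kronecker_id_left graph_laplacian_ring)
qed

section \<open>The centred nonlinearity\<close>

text \<open>
With \<open>z\<close> and \<open>h\<close> the increments of \<open>\<phi>\<close> and of its argument,
\<open>(z - h / \<delta>)\<^sup>2 = h\<^sup>2 / \<delta>\<^sup>2 - (2 / \<delta>) z (h - (\<delta> / 2) z)\<close>, and the incremental sector
condition makes the subtracted term nonnegative.
\<close>

lemma admissible_centered_contraction:
  assumes adm: "admissible_nonlinearity \<delta> \<phi>" and \<delta>: "0 < \<delta>"
  shows "((\<phi> y t - y / \<delta>) - (\<phi> y' t - y' / \<delta>))\<^sup>2 \<le> (y - y')\<^sup>2 / \<delta>\<^sup>2"
proof (cases "y = y'")
  case False
  define z where "z = \<phi> y t - \<phi> y' t"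
  define h where "h = y - y'"
  have "0 < z * (h - \<delta> / 2 * z)"
    using adm False by (simp add: admissible_nonlinearity_def z_def h_def)
  moreover have "(z - h / \<delta>)\<^sup>2 = h\<^sup>2 / \<delta>\<^sup>2 - 2 / \<delta> * (z * (h - \<delta> / 2 * z))"
    using \<delta> by (simp add: field_simps power2_eq_square)
  ultimately have "(z - h / \<delta>)\<^sup>2 \<le> h\<^sup>2 / \<delta>\<^sup>2" using \<delta> by simp
  then show ?thesis by (simp add: z_def h_def diff_divide_distrib algebra_simps)
qed simp

lemma disagreement_centered_nonlinearity:
  assumes adm: "admissible_nonlinearity \<delta> \<phi>" and \<delta>: "0 < \<delta>"
  shows "disagreement n (\<lambda>k. x k / \<delta> - \<phi> (x k) t) \<le> disagreement n x / \<delta>\<^sup>2"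
  unfolding disagreement_def sum_divide_distrib
proof (intro sum_mono)
  fix i j
  have "x i / \<delta> - \<phi> (x i) t - (x j / \<delta> - \<phi> (x j) t)
      = - ((\<phi> (x i) t - x i / \<delta>) - (\<phi> (x j) t - x j / \<delta>))" by simp
  then show "(x i / \<delta> - \<phi> (x i) t - (x j / \<delta> - \<phi> (x j) t))\<^sup>2 \<le> (x i - x j)\<^sup>2 / \<delta>\<^sup>2"
    using admissible_centered_contraction[OF adm \<delta>, of "x i" t "x j"] by (simp only: power2_minus)
qed

section \<open>Square integrability and the noise covariance\<close>

definition square_integrable :: "'w measure \<Rightarrow> ('w \<Rightarrow> real) \<Rightarrow> bool" where
  "square_integrable M f \<longleftrightarrow> f \<in> borel_measurable M \<and> integrable M (\<lambda>w. (f w)\<^sup>2)"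

lemma square_integrable_mult:
  assumes f: "square_integrable M f" and g: "square_integrable M g"
  shows "integrable M (\<lambda>w. f w * g w)"
proof (rule Bochner_Integration.integrable_bound)
  show "integrable M (\<lambda>w. (f w)\<^sup>2 + (g w)\<^sup>2)"
    using f g by (auto simp: square_integrable_def)
  show "(\<lambda>w. f w * g w) \<in> borel_measurable M"
    using f g by (auto simp: square_integrable_def)
  have "\<bar>a * b\<bar> \<le> a\<^sup>2 + b\<^sup>2" for a b :: real
  proof -
    have "2 * (\<bar>a\<bar> * \<bar>b\<bar>) \<le> a\<^sup>2 + b\<^sup>2" using sum_squares_bound[of "\<bar>a\<bar>" "\<bar>b\<bar>"] by simp
    moreover have "0 \<le> \<bar>a\<bar> * \<bar>b\<bar>" by simp
    ultimately show ?thesis unfolding abs_mult by linarith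
  qed
  then show "AE w in M. norm (f w * g w) \<le> norm ((f w)\<^sup>2 + (g w)\<^sup>2)"
    by auto
qed

lemma square_integrable_cmult:
  "square_integrable M f \<Longrightarrow> square_integrable M (\<lambda>w. c * f w)"
  by (auto simp: square_integrable_def power_mult_distrib)

lemma square_integrable_add:
  assumes "square_integrable M f" "square_integrable M g"
  shows "square_integrable M (\<lambda>w. f w + g w)"
  using assms square_integrable_mult[OF assms]
  by (auto simp: square_integrable_def power2_sum mult.assoc)

lemma square_integrable_diff:
  assumes "square_integrable M f" "square_integrable M g"
  shows "square_integrable M (\<lambda>w. f w - g w)"
  using square_integrable_add[OF assms(1) square_integrable_cmult[OF assms(2), of "-1"]] by simp

lemma square_integrable_sum:
  assumes "\<And>i. i \<in> I \<Longrightarrow> square_integrable M (f i)"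
  shows "square_integrable M (\<lambda>w. \<Sum>i\<in>I. f i w)"
  using assms
proof (induction I rule: infinite_finite_induct)
  case (insert i I)
  then show ?case by (simp add: square_integrable_add)
qed (auto simp: square_integrable_def)

lemma square_integrable_bound:
  assumes f: "square_integrable M f" and g: "g \<in> borel_measurable M"
    and le: "\<And>w. \<bar>g w\<bar> \<le> \<bar>f w\<bar>"
  shows "square_integrable M g"
  unfolding square_integrable_def
proof (rule conjI[OF g], rule Bochner_Integration.integrable_bound)
  show "integrable M (\<lambda>w. (f w)\<^sup>2)" using f by (simp add: square_integrable_def)
  show "AE w in M. norm ((g w)\<^sup>2) \<le> norm ((f w)\<^sup>2)"
    using le by (auto simp: abs_le_square_iff[symmetric])
qed (use g in simp)

lemma square_integrable_mat_app:
  assumes "\<And>k. k < n \<Longrightarrow> square_integrable M (\<lambda>w. x w k)"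
  shows "square_integrable M (\<lambda>w. mat_app L n (x w) k)"
  unfolding mat_app_def using assms by (intro square_integrable_sum square_integrable_cmult) auto

lemma integrable_disagreement:
  assumes "\<And>k. k < n \<Longrightarrow> square_integrable M (\<lambda>w. x w k)"
  shows "integrable M (\<lambda>w. disagreement n (x w))"
  unfolding disagreement_def
proof (intro Bochner_Integration.integrable_sum)
  fix i j assume "i \<in> {..<n}" "j \<in> {..<n}"
  then have "square_integrable M (\<lambda>w. x w i - x w j)"
    using assms by (intro square_integrable_diff) auto
  then show "integrable M (\<lambda>w. (x w i - x w j)\<^sup>2)" by (simp add: square_integrable_def)
qed

lemma integrable_codisagreement:
  assumes "\<And>k. k < n \<Longrightarrow> square_integrable M (\<lambda>w. x w k)" "\<And>k. k < n \<Longrightarrow> square_integrable M (\<lambda>w. y w k)"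
  shows "integrable M (\<lambda>w. codisagreement n (x w) (y w))"
  unfolding codisagreement_def
proof (intro Bochner_Integration.integrable_sum)
  fix i j assume "i \<in> {..<n}" "j \<in> {..<n}"
  then show "integrable M (\<lambda>w. (x w i - x w j) * (y w i - y w j))"
    using assms by (intro square_integrable_mult square_integrable_diff) auto
qed

text \<open>
The diagonal entry is a coordinate of the image of a unit vector. The supremum defining the norm is
one of real numbers, so the set has to be shown bounded.
\<close>

lemma diagonal_le_spectral_norm:
  assumes R: "R \<in> carrier_mat n n" and k: "k < n"
  shows "R $$ (k, k) \<le> spectral_norm R"
proof -
  have norm: "euclidean_norm x = sqrt (\<Sum>i<n. (x $ i)\<^sup>2)" if "x \<in> carrier_vec n" for x
    using that by (simp add: euclidean_norm_def scalar_prod_def lessThan_atLeast0 power2_eq_square)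
  have app: "(R *\<^sub>v x) $ i = (\<Sum>j<n. R $$ (i, j) * x $ j)" if "x \<in> carrier_vec n" "i < n" for x i
    using that R by (simp add: scalar_prod_def lessThan_atLeast0)
  let ?B = "{x \<in> carrier_vec (dim_col R). euclidean_norm x \<le> 1}"
  have "bdd_above ((\<lambda>x. euclidean_norm (R *\<^sub>v x)) ` ?B)"
  proof (rule bdd_aboveI2[where M = "sqrt (\<Sum>i<n. (\<Sum>j<n. \<bar>R $$ (i, j)\<bar>)\<^sup>2)"])
    fix x assume "x \<in> ?B"
    then have x: "x \<in> carrier_vec n" and "euclidean_norm x \<le> 1" using R by auto
    then have sq: "(\<Sum>i<n. (x $ i)\<^sup>2) \<le> 1" by (simp add: norm)
    have x1: "\<bar>x $ j\<bar> \<le> 1" if "j < n" for j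
    proof -
      have "(x $ j)\<^sup>2 \<le> (\<Sum>i<n. (x $ i)\<^sup>2)" using that by (intro member_le_sum) auto
      then have "(x $ j)\<^sup>2 \<le> 1" using sq by simp
      then show ?thesis by (simp add: abs_square_le_1)
    qed
    have "\<bar>(R *\<^sub>v x) $ i\<bar> \<le> (\<Sum>j<n. \<bar>R $$ (i, j)\<bar>)" if "i < n" for i
    proof -
      have "\<bar>(R *\<^sub>v x) $ i\<bar> \<le> (\<Sum>j<n. \<bar>R $$ (i, j) * x $ j\<bar>)"
        unfolding app[OF x that] by (rule sum_abs)
      also have "\<dots> \<le> (\<Sum>j<n. \<bar>R $$ (i, j)\<bar>)"
        using x1 by (intro sum_mono) (auto simp: abs_mult intro: mult_left_le)
      finally show ?thesis .
    qed
    then have "((R *\<^sub>v x) $ i)\<^sup>2 \<le> (\<Sum>j<n. \<bar>R $$ (i, j)\<bar>)\<^sup>2" if "i < n" for i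
      using that by (intro abs_le_square_iff[THEN iffD1]) (simp add: sum_nonneg)
    then show "euclidean_norm (R *\<^sub>v x) \<le> sqrt (\<Sum>i<n. (\<Sum>j<n. \<bar>R $$ (i, j)\<bar>)\<^sup>2)"
      using R x by (subst norm) (auto intro!: sum_mono)
  qed
  moreover have "unit_vec n k \<in> ?B"
  proof -
    have "(\<Sum>i<n. (unit_vec n k $ i :: real)\<^sup>2) = (\<Sum>i<n. if i = k then 1 else 0)"
      using k by (intro sum.cong) auto
    then show ?thesis using R k by (simp add: norm)
  qed
  ultimately have "euclidean_norm (R *\<^sub>v unit_vec n k) \<le> spectral_norm R"
    unfolding spectral_norm_def by (intro cSUP_upper)
  moreover have "(R *\<^sub>v unit_vec n k) $ k = R $$ (k, k)"
    using R k by simp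
  then have "R $$ (k, k) \<le> euclidean_norm (R *\<^sub>v unit_vec n k)"
  proof -
    have "(R $$ (k, k))\<^sup>2 \<le> (\<Sum>i<n. ((R *\<^sub>v unit_vec n k) $ i)\<^sup>2)"
      unfolding \<open>(R *\<^sub>v unit_vec n k) $ k = R $$ (k, k)\<close>[symmetric] using k by (intro member_le_sum) auto
    then have "\<bar>R $$ (k, k)\<bar> \<le> euclidean_norm (R *\<^sub>v unit_vec n k)"
      using R by (subst norm) (auto intro: real_le_rsqrt)
    then show ?thesis by simp
  qed
  ultimately show ?thesis by simp
qed

section \<open>Independence of random elements with different value spaces\<close>

text \<open>
Unlike for \<open>indep_var\<close>, the two value spaces may have different types: the present uncertainty is
a real number, and the past is a pair of histories.
\<close>

definition (in prob_space) indep_pair where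
  "indep_pair S A T B \<longleftrightarrow> A \<in> measurable M S \<and> B \<in> measurable M T \<and>
     (\<forall>X\<in>sets S. \<forall>Y\<in>sets T. emeasure M ((\<lambda>w. (A w, B w)) -` (X \<times> Y) \<inter> space M)
        = emeasure M (A -` X \<inter> space M) * emeasure M (B -` Y \<inter> space M))"

lemma (in prob_space) indep_pair_law:
  assumes "indep_pair S A T B"
  shows "distr M S A \<Otimes>\<^sub>M distr M T B = distr M (S \<Otimes>\<^sub>M T) (\<lambda>w. (A w, B w))"
proof (rule pair_measure_eqI)
  have [measurable]: "A \<in> measurable M S" "B \<in> measurable M T"
    using assms by (auto simp: indep_pair_def)
  interpret A: prob_space "distr M S A" by (rule prob_space_distr) simp
  interpret B: prob_space "distr M T B" by (rule prob_space_distr) simp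
  show "sigma_finite_measure (distr M S A)" "sigma_finite_measure (distr M T B)" by unfold_locales
  fix X Y assume "X \<in> sets (distr M S A)" "Y \<in> sets (distr M T B)"
  then show "emeasure (distr M S A) X * emeasure (distr M T B) Y
      = emeasure (distr M (S \<Otimes>\<^sub>M T) (\<lambda>w. (A w, B w))) (X \<times> Y)"
    using assms by (simp add: indep_pair_def emeasure_distr)
qed simp

lemma (in prob_space) indep_pair_iff_indep_var: "indep_pair S A T B \<longleftrightarrow> indep_var S A T B"
proof
  assume "indep_pair S A T B"
  then show "indep_var S A T B"
    by (simp add: indep_var_distribution_eq indep_pair_law) (simp add: indep_pair_def)
next
  assume AB: "indep_var S A T B"
  then have [measurable]: "A \<in> measurable M S" "B \<in> measurable M T"
    by (auto dest: indep_var_rv1 indep_var_rv2)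
  show "indep_pair S A T B"
    using indep_varD[OF AB]
    by (simp add: indep_pair_def emeasure_eq_measure ennreal_mult[symmetric])
qed

lemma (in prob_space) indep_pair_compose:
  assumes AB: "indep_pair S A T B" and f: "f \<in> measurable S S'" and g: "g \<in> measurable T T'"
  shows "indep_pair S' (\<lambda>w. f (A w)) T' (\<lambda>w. g (B w))"
proof -
  have [measurable]: "A \<in> measurable M S" "B \<in> measurable M T"
    using AB by (auto simp: indep_pair_def)
  have "emeasure M ((\<lambda>w. (f (A w), g (B w))) -` (X \<times> Y) \<inter> space M)
      = emeasure M ((\<lambda>w. f (A w)) -` X \<inter> space M) * emeasure M ((\<lambda>w. g (B w)) -` Y \<inter> space M)"
    if X: "X \<in> sets S'" and Y: "Y \<in> sets T'" for X Y
  proof -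
    have "(\<lambda>w. (f (A w), g (B w))) -` (X \<times> Y) \<inter> space M
        = (\<lambda>w. (A w, B w)) -` ((f -` X \<inter> space S) \<times> (g -` Y \<inter> space T)) \<inter> space M"
      "(\<lambda>w. f (A w)) -` X \<inter> space M = A -` (f -` X \<inter> space S) \<inter> space M"
      "(\<lambda>w. g (B w)) -` Y \<inter> space M = B -` (g -` Y \<inter> space T) \<inter> space M"
      using measurable_space[of A M S] measurable_space[of B M T] by auto
    then show ?thesis
      using AB measurable_sets[OF f X] measurable_sets[OF g Y] by (simp add: indep_pair_def)
  qed
  then show ?thesis using f g by (simp add: indep_pair_def)
qed

text \<open>
If \<open>A\<close> is independent of \<open>B\<close>, and \<open>C\<close> of the pair \<open>(A, B)\<close>, then \<open>A\<close> is independent of \<open>(B, C)\<close>. Fix the value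
of \<open>C\<close> by Fubini: the slice of the event is a rectangle for \<open>(A, B)\<close>, from which the probability
of \<open>A \<in> X\<close> factors out.
\<close>

lemma (in prob_space) indep_pair_regroup:
  assumes AB: "indep_pair S A T B"
    and ABC: "indep_pair (S \<Otimes>\<^sub>M T) (\<lambda>w. (A w, B w)) U C"
  shows "indep_pair S A (T \<Otimes>\<^sub>M U) (\<lambda>w. (B w, C w))"
proof -
  have [measurable]: "A \<in> measurable M S" "B \<in> measurable M T" "C \<in> measurable M U"
    using AB ABC by (auto simp: indep_pair_def)
  have BC: "indep_pair T B U C"
    using indep_pair_compose[OF ABC measurable_snd measurable_ident_sets[OF refl]] by simp
  let ?A = "distr M S A" and ?B = "distr M T B" and ?C = "distr M U C"
  let ?AB = "distr M (S \<Otimes>\<^sub>M T) (\<lambda>w. (A w, B w))"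
  let ?BC = "distr M (T \<Otimes>\<^sub>M U) (\<lambda>w. (B w, C w))"
  interpret A: prob_space ?A by (rule prob_space_distr) simp
  interpret B: prob_space ?B by (rule prob_space_distr) simp
  interpret C: prob_space ?C by (rule prob_space_distr) simp
  interpret AB: prob_space ?AB by (rule prob_space_distr) simp
  interpret BC: prob_space ?BC by (rule prob_space_distr) simp
  interpret ABC: pair_prob_space ?AB ?C ..
  interpret B_C: pair_prob_space ?B ?C ..
  have law_AB: "?AB = ?A \<Otimes>\<^sub>M ?B" and law_BC: "?BC = ?B \<Otimes>\<^sub>M ?C"
    and law_ABC: "distr M ((S \<Otimes>\<^sub>M T) \<Otimes>\<^sub>M U) (\<lambda>w. ((A w, B w), C w)) = ?AB \<Otimes>\<^sub>M ?C"
    using indep_pair_law[OF AB] indep_pair_law[OF BC] indep_pair_law[OF ABC] by auto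
  have "emeasure M ((\<lambda>w. (A w, (B w, C w))) -` (X \<times> E) \<inter> space M)
      = emeasure M (A -` X \<inter> space M) * emeasure M ((\<lambda>w. (B w, C w)) -` E \<inter> space M)"
    if X [measurable]: "X \<in> sets S" and E [measurable]: "E \<in> sets (T \<Otimes>\<^sub>M U)" for X E
  proof -
    (* The event in the other bracketing. *)
    define G where "G = (\<lambda>z. (fst (fst z), (snd (fst z), snd z))) -` (X \<times> E) \<inter> space ((S \<Otimes>\<^sub>M T) \<Otimes>\<^sub>M U)"
    have G [measurable]: "G \<in> sets ((S \<Otimes>\<^sub>M T) \<Otimes>\<^sub>M U)"
      unfolding G_def by (rule measurable_sets[OF _ pair_measureI[OF X E]]) measurable
    have slice: "(\<lambda>z. (z, c)) -` G = X \<times> (\<lambda>b. (b, c)) -` E" if "c \<in> space U" for c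
      using sets.sets_into_space[OF X] sets.sets_into_space[OF E] that
      by (auto simp: G_def space_pair_measure)
    have "(\<lambda>w. (A w, (B w, C w))) -` (X \<times> E) \<inter> space M
        = (\<lambda>w. ((A w, B w), C w)) -` G \<inter> space M"
      using measurable_space[of A M S] measurable_space[of B M T] measurable_space[of C M U]
      by (auto simp: G_def space_pair_measure)
    then have "emeasure M ((\<lambda>w. (A w, (B w, C w))) -` (X \<times> E) \<inter> space M)
        = emeasure M ((\<lambda>w. ((A w, B w), C w)) -` G \<inter> space M)" by simp
    also have "\<dots> = emeasure (?AB \<Otimes>\<^sub>M ?C) G"
      unfolding law_ABC[symmetric] by (rule emeasure_distr[symmetric]) auto
    also have "\<dots> = (\<integral>\<^sup>+c. emeasure ?AB ((\<lambda>z. (z, c)) -` G) \<partial>?C)"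
      by (rule ABC.emeasure_pair_measure_alt2) (simp cong: sets_pair_measure_cong)
    also have "\<dots> = (\<integral>\<^sup>+c. emeasure ?A X * emeasure ?B ((\<lambda>b. (b, c)) -` E) \<partial>?C)"
    proof (rule nn_integral_cong)
      fix c assume "c \<in> space ?C"
      then show "emeasure ?AB ((\<lambda>z. (z, c)) -` G) = emeasure ?A X * emeasure ?B ((\<lambda>b. (b, c)) -` E)"
        unfolding law_AB using X sets_Pair2[OF E, of c]
        by (simp add: slice B.emeasure_pair_measure_Times del: emeasure_distr)
    qed
    also have "\<dots> = emeasure ?A X * (\<integral>\<^sup>+c. emeasure ?B ((\<lambda>b. (b, c)) -` E) \<partial>?C)"
      by (rule nn_integral_cmult) (use B_C.measurable_emeasure_Pair2 in simp)
    also have "(\<integral>\<^sup>+c. emeasure ?B ((\<lambda>b. (b, c)) -` E) \<partial>?C) = emeasure ?BC E"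
      unfolding law_BC by (rule B_C.emeasure_pair_measure_alt2[symmetric]) (simp cong: sets_pair_measure_cong)
    finally show ?thesis using X E by (simp add: emeasure_distr)
  qed
  then show ?thesis by (simp add: indep_pair_def)
qed

section \<open>The uncertainty is independent of the current state\<close>

lemma network_state_Suc_index:
  assumes L: "L \<in> carrier_mat n n" and x: "network_state L a g \<mu> \<phi> \<xi> v x0 t w \<in> carrier_vec n" and k: "k < n"
  shows "network_state L a g \<mu> \<phi> \<xi> v x0 (Suc t) w $ k =
    a * network_state L a g \<mu> \<phi> \<xi> v x0 t w $ k
    - (\<mu> + \<xi> t w) * g * mat_app L n (\<lambda>j. network_state L a g \<mu> \<phi> \<xi> v x0 t w $ j) k
    - \<phi> (network_state L a g \<mu> \<phi> \<xi> v x0 t w $ k) t + v t k w"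
proof -
  define x where "x = network_state L a g \<mu> \<phi> \<xi> v x0 t w"
  define c where "c = (\<mu> + \<xi> t w) * g"
  have xc: "x \<in> carrier_vec n" using x by (simp add: x_def)
  have "((a \<cdot>\<^sub>m 1\<^sub>m n - c \<cdot>\<^sub>m L) *\<^sub>v x) $ k = (\<Sum>j<n. (a * (if k = j then 1 else 0) - c * L $$ (k, j)) * x $ j)"
    using L xc k by (simp add: scalar_prod_def lessThan_atLeast0)
  also have "\<dots> = (\<Sum>j<n. (if k = j then a * x $ j else 0) - c * (L $$ (k, j) * x $ j))"
    by (intro sum.cong refl) (simp add: algebra_simps)
  also have "\<dots> = a * x $ k - c * mat_app L n (\<lambda>j. x $ j) k"
    using k by (simp add: sum_subtractf mat_app_def sum_distrib_left)
  finally have "((a \<cdot>\<^sub>m 1\<^sub>m n - c \<cdot>\<^sub>m L) *\<^sub>v x) $ k = a * x $ k - c * mat_app L n (\<lambda>j. x $ j) k" .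
  then show ?thesis
    using L xc k unfolding network_state.simps x_def[symmetric] c_def[symmetric] by simp
qed

lemma network_state_carrier:
  assumes L: "L \<in> carrier_mat n n" and x0: "x0 \<in> carrier_vec n"
  shows "network_state L a g \<mu> \<phi> \<xi> v x0 t w \<in> carrier_vec n"
proof (cases t)
  case 0
  then show ?thesis using x0 by simp
next
  case (Suc s)
  then show ?thesis using L by (intro carrier_vecI) simp
qed

text \<open>
The state at time \<open>t\<close> depends only on the disturbances before \<open>t\<close>. The two systems may live on
different sample spaces, so that the state can be compared with its counterpart on a space of
disturbance histories.
\<close>

lemma network_state_cong:
  assumes "L \<in> carrier_mat n n"
    and "\<And>s. s < t \<Longrightarrow> \<xi> s w = \<xi>' s z"
    and "\<And>s k. s < t \<Longrightarrow> k < n \<Longrightarrow> v s k w = v' s k z"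
  shows "network_state L a g \<mu> \<phi> \<xi> v x0 t w = network_state L a g \<mu> \<phi> \<xi>' v' x0 t z"
  using assms(2,3)
proof (induction t)
  case (Suc t)
  have "network_state L a g \<mu> \<phi> \<xi> v x0 t w = network_state L a g \<mu> \<phi> \<xi>' v' x0 t z"
    by (rule Suc.IH) (use Suc.prems in auto)
  moreover have "\<xi> t w = \<xi>' t z" using Suc.prems(1) by simp
  moreover have "vec (dim_row L) (\<lambda>k. v t k w) = vec (dim_row L) (\<lambda>k. v' t k z)"
    using assms(1) Suc.prems(2)[of t] by (intro eq_vecI) auto
  ultimately show ?case by (simp only: network_state.simps)
qed simp

lemma measurable_network_state:
  assumes L: "L \<in> carrier_mat n n" and x0: "x0 \<in> carrier_vec n"
    and phi: "\<And>s. (\<lambda>y. \<phi> y s) \<in> borel_measurable borel"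
    and xi: "\<And>s. s < t \<Longrightarrow> \<xi> s \<in> borel_measurable M"
    and v: "\<And>s k. k < n \<Longrightarrow> v s k \<in> borel_measurable M"
    and k: "k < n"
  shows "(\<lambda>w. network_state L a g \<mu> \<phi> \<xi> v x0 t w $ k) \<in> borel_measurable M"
  using xi k
proof (induction t arbitrary: k)
  case 0
  show ?case by (simp only: network_state.simps borel_measurable_const)
next
  case (Suc t)
  have [measurable]: "\<xi> t \<in> borel_measurable M" "v t k \<in> borel_measurable M"
    "(\<lambda>y. \<phi> y t) \<in> borel_measurable borel"
    using Suc.prems v phi by auto
  have IH [measurable]: "(\<lambda>w. network_state L a g \<mu> \<phi> \<xi> v x0 t w $ j) \<in> borel_measurable M" if "j < n" for j
    using Suc that by simp
  note [measurable] = IH[OF Suc.prems(2)]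
  have [measurable]: "(\<lambda>w. mat_app L n (\<lambda>j. network_state L a g \<mu> \<phi> \<xi> v x0 t w $ j) k) \<in> borel_measurable M"
    unfolding mat_app_def by (intro borel_measurable_sum borel_measurable_times borel_measurable_const IH) simp
  have "(\<lambda>w. \<phi> (network_state L a g \<mu> \<phi> \<xi> v x0 t w $ k) t) \<in> borel_measurable M"
    by (rule measurable_compose[of _ M borel "\<lambda>y. \<phi> y t"]) simp_all
  then show ?case
    unfolding network_state_Suc_index[OF L network_state_carrier[OF L x0] Suc.prems(2)]
    by measurable
qed

text \<open>
The whole noise process may be included in the past, future values as well, because it is
independent of the uncertainty as a process.
\<close>

lemma (in prob_space) uncertainty_indep_of_past:
  assumes xi: "indep_vars (\<lambda>_. borel) \<xi> (UNIV :: nat set)"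
    and proc: "independent_processes M n \<xi> v"
  shows "indep_pair borel (\<xi> t)
    ((\<Pi>\<^sub>M s\<in>{..<t}. borel) \<Otimes>\<^sub>M (\<Pi>\<^sub>M p\<in>UNIV \<times> {..<n}. borel))
    (\<lambda>w. (\<lambda>s\<in>{..<t}. \<xi> s w, \<lambda>(s, k)\<in>UNIV \<times> {..<n}. v s k w))"
proof -
  have "indep_var (\<Pi>\<^sub>M s\<in>{t}. borel) (\<lambda>w. restrict (\<lambda>s. \<xi> s w) {t})
      (\<Pi>\<^sub>M s\<in>{..<t}. borel) (\<lambda>w. restrict (\<lambda>s. \<xi> s w) {..<t})"
    by (rule indep_var_restrict[OF xi, of "{t}" "{..<t}"]) auto
  then have single: "indep_pair (\<Pi>\<^sub>M s\<in>{t}. borel) (\<lambda>w. restrict (\<lambda>s. \<xi> s w) {t})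
      (\<Pi>\<^sub>M s\<in>{..<t}. borel) (\<lambda>w. restrict (\<lambda>s. \<xi> s w) {..<t})"
    by (simp only: indep_pair_iff_indep_var)
  have "(\<lambda>f. f t) \<in> measurable (\<Pi>\<^sub>M s\<in>{t}. borel) (borel :: real measure)"
    by (rule measurable_component_singleton) simp
  from indep_pair_compose[OF single this measurable_ident]
  have present_past: "indep_pair borel (\<xi> t) (\<Pi>\<^sub>M s\<in>{..<t}. borel) (\<lambda>w. \<lambda>s\<in>{..<t}. \<xi> s w)"
    by (simp add: id_def)
  (* Present value and past of an uncertainty history, indexed by pairs with dummy second entry. *)
  define Y where "Y = (\<lambda>f :: nat \<times> nat \<Rightarrow> real. (f (t, 0), \<lambda>s\<in>{..<t}. f (s, 0)))"
  have Y: "Y \<in> measurable (\<Pi>\<^sub>M p\<in>UNIV \<times> {0}. borel) (borel \<Otimes>\<^sub>M (\<Pi>\<^sub>M s\<in>{..<t}. borel))"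
    unfolding Y_def
  proof (rule measurable_Pair)
    show "(\<lambda>f. f (t, 0)) \<in> borel_measurable (\<Pi>\<^sub>M p\<in>UNIV \<times> {0}. (borel :: real measure))"
      by (rule measurable_component_singleton) simp
    show "(\<lambda>f. \<lambda>s\<in>{..<t}. f (s, 0)) \<in>
        measurable (\<Pi>\<^sub>M p\<in>UNIV \<times> {0}. (borel :: real measure)) (\<Pi>\<^sub>M s\<in>{..<t}. borel)"
      by (rule measurable_restrict, rule measurable_component_singleton) simp
  qed
  have "indep_pair (\<Pi>\<^sub>M p\<in>UNIV \<times> {0 :: nat}. borel) (\<lambda>w. \<lambda>(s, k)\<in>UNIV \<times> {0}. \<xi> s w)
      (\<Pi>\<^sub>M p\<in>UNIV \<times> {..<n}. borel) (\<lambda>w. \<lambda>(s, k)\<in>UNIV \<times> {..<n}. v s k w)"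
    using proc by (simp only: independent_processes_def indep_pair_iff_indep_var)
  from indep_pair_compose[OF this Y measurable_ident]
  have "indep_pair (borel \<Otimes>\<^sub>M (\<Pi>\<^sub>M s\<in>{..<t}. borel)) (\<lambda>w. (\<xi> t w, \<lambda>s\<in>{..<t}. \<xi> s w))
     (\<Pi>\<^sub>M p\<in>UNIV \<times> {..<n}. borel) (\<lambda>w. \<lambda>(s, k)\<in>UNIV \<times> {..<n}. v s k w)"
    by (simp add: Y_def id_def)
  with present_past show ?thesis by (rule indep_pair_regroup)
qed

text \<open>
The state is a measurable function of the past: the function is the network dynamics itself, run on
the space of histories with the coordinates as disturbances.
\<close>

lemma (in prob_space) uncertainty_indep_of_state:
  assumes xi: "indep_vars (\<lambda>_. borel) \<xi> (UNIV :: nat set)"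
    and proc: "independent_processes M n \<xi> v"
    and L: "L \<in> carrier_mat n n" and x0: "x0 \<in> carrier_vec n"
    and phi: "\<And>s. (\<lambda>y. \<phi> y s) \<in> borel_measurable borel"
  shows "indep_pair borel (\<xi> t) (\<Pi>\<^sub>M k\<in>{..<n}. borel)
    (\<lambda>w. \<lambda>k\<in>{..<n}. network_state L a g \<mu> \<phi> \<xi> v x0 t w $ k)"
proof -
  let ?\<Omega> = "(\<Pi>\<^sub>M s\<in>{..<t}. borel) \<Otimes>\<^sub>M (\<Pi>\<^sub>M p\<in>UNIV \<times> {..<n}. borel) :: ((nat \<Rightarrow> real) \<times> (nat \<times> nat \<Rightarrow> real)) measure"
  define F where "F = (\<lambda>z :: (nat \<Rightarrow> real) \<times> (nat \<times> nat \<Rightarrow> real). \<lambda>k\<in>{..<n}.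
    network_state L a g \<mu> \<phi> (\<lambda>s z. fst z s) (\<lambda>s k z. snd z (s, k)) x0 t z $ k)"
  have F: "F \<in> measurable ?\<Omega> (\<Pi>\<^sub>M k\<in>{..<n}. borel)"
    unfolding F_def
  proof (rule measurable_restrict)
    fix k assume "k \<in> {..<n}"
    then have k: "k < n" by simp
    have xi': "(\<lambda>z. fst z s) \<in> borel_measurable ?\<Omega>" if "s < t" for s
      by (rule measurable_compose[OF measurable_fst measurable_component_singleton]) (use that in simp)
    have v': "(\<lambda>z. snd z (s, k)) \<in> borel_measurable ?\<Omega>" if "k < n" for s k
      by (rule measurable_compose[OF measurable_snd measurable_component_singleton]) (use that in simp)
    show "(\<lambda>z. network_state L a g \<mu> \<phi> (\<lambda>s z. fst z s) (\<lambda>s k z. snd z (s, k)) x0 t z $ k)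
        \<in> borel_measurable ?\<Omega>"
      by (rule measurable_network_state[OF L x0 phi xi' v' k])
  qed
  have "network_state L a g \<mu> \<phi> (\<lambda>s z. fst z s) (\<lambda>s k z. snd z (s, k)) x0 t
      (\<lambda>s\<in>{..<t}. \<xi> s w, \<lambda>(s, k)\<in>UNIV \<times> {..<n}. v s k w)
    = network_state L a g \<mu> \<phi> \<xi> v x0 t w" for w
    by (rule network_state_cong[OF L]) auto
  then show ?thesis
    using indep_pair_compose[OF uncertainty_indep_of_past[OF xi proc] measurable_ident F]
    by (simp add: F_def id_def)
qed

section \<open>Evolution of the expected disagreement\<close>

locale noisy_network = prob_space M for M :: "'w measure" +
  fixes n :: nat and L :: "real mat" and a g \<mu> \<sigma> \<delta> :: real and \<phi> :: "real \<Rightarrow> nat \<Rightarrow> real"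
    and \<xi> :: "nat \<Rightarrow> 'w \<Rightarrow> real" and v :: "nat \<Rightarrow> nat \<Rightarrow> 'w \<Rightarrow> real" and R :: "real mat"
  assumes delta_pos: "0 < \<delta>"
    and laplacian: "graph_laplacian n L"
    and admissible: "admissible_nonlinearity \<delta> \<phi>"
    and uncertainty: "link_uncertainty M \<xi> \<sigma>"
    and noise: "additive_noise M n v R"
    and independent: "independent_processes M n \<xi> v"
begin

definition state :: "real vec \<Rightarrow> nat \<Rightarrow> 'w \<Rightarrow> nat \<Rightarrow> real" where
  "state x0 t w k = network_state L a g \<mu> \<phi> \<xi> v x0 t w $ k"

lemma L_carrier: "L \<in> carrier_mat n n"
  using laplacian by (simp add: graph_laplacian_def)

lemma nonlinearity_measurable: "(\<lambda>y. \<phi> y t) \<in> borel_measurable borel"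
proof -
  obtain C where "C-lipschitz_on UNIV (\<lambda>y. \<phi> y t)"
    using admissible unfolding admissible_nonlinearity_def by blast
  then show ?thesis
    by (intro borel_measurable_continuous_onI lipschitz_on_continuous_on)
qed

lemma uncertainty_indep_vars: "indep_vars (\<lambda>_. borel) \<xi> UNIV"
  using uncertainty by (simp add: link_uncertainty_def)

lemma square_integrable_uncertainty: "square_integrable M (\<xi> t)"
  using uncertainty uncertainty_indep_vars
  by (simp add: square_integrable_def link_uncertainty_def indep_vars_def)

lemma integrable_uncertainty: "integrable M (\<xi> t)"
  using square_integrable_mult[OF square_integrable_uncertainty, of "\<lambda>_. 1"]
  by (simp add: square_integrable_def)

lemma mean_uncertainty: "expectation (\<xi> t) = 0"
  and second_moment_uncertainty: "expectation (\<lambda>w. (\<xi> t w)\<^sup>2) = \<sigma>\<^sup>2"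
proof -
  show m: "expectation (\<xi> t) = 0" using uncertainty by (simp add: link_uncertainty_def)
  have "variance (\<xi> t) = \<sigma>\<^sup>2" using uncertainty unfolding link_uncertainty_def by blast
  then show "expectation (\<lambda>w. (\<xi> t w)\<^sup>2) = \<sigma>\<^sup>2" by (simp only: m diff_zero)
qed

lemma square_integrable_noise: "k < n \<Longrightarrow> square_integrable M (v t k)"
  using noise by (simp add: square_integrable_def additive_noise_def)

text \<open>
The gain is already shifted from \<open>a\<close> to \<open>a - 1 / \<delta>\<close>; the matching term \<open>x / \<delta>\<close> is absorbed into
the nonlinearity.
\<close>

definition linear_part :: "real vec \<Rightarrow> nat \<Rightarrow> 'w \<Rightarrow> nat \<Rightarrow> real" where
  "linear_part x0 t w k = (a - 1 / \<delta>) * state x0 t w k - (\<mu> * g) * mat_app L n (state x0 t w) k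
      - (\<xi> t w * g) * mat_app L n (state x0 t w) k"

lemma state_Suc:
  assumes "x0 \<in> carrier_vec n" "k < n"
  shows "state x0 (Suc t) w k =
    linear_part x0 t w k + (state x0 t w k / \<delta> - \<phi> (state x0 t w k) t) + v t k w"
proof -
  have state: "state x0 t w = (\<lambda>j. network_state L a g \<mu> \<phi> \<xi> v x0 t w $ j)" by (simp add: state_def fun_eq_iff)
  show ?thesis
    unfolding state_def[of x0 "Suc t"] state
      network_state_Suc_index[OF L_carrier network_state_carrier[OF L_carrier assms(1)] assms(2)]
    by (simp add: linear_part_def state algebra_simps)
qed

lemma measurable_state:
  assumes "x0 \<in> carrier_vec n" "k < n"
  shows "(\<lambda>w. state x0 t w k) \<in> borel_measurable M"
  unfolding state_def
  by (rule measurable_network_state[where \<phi> = \<phi>, OF L_carrier assms(1) nonlinearity_measurable _ _ assms(2)])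
    (use square_integrable_uncertainty square_integrable_noise in \<open>auto simp: square_integrable_def\<close>)

lemma uncertainty_indep_functional:
  assumes x0: "x0 \<in> carrier_vec n"
    and f: "f \<in> borel_measurable borel"
    and H: "H \<in> borel_measurable (\<Pi>\<^sub>M k\<in>{..<n}. borel)"
  shows "indep_var borel (\<lambda>w. f (\<xi> t w) :: real) borel (\<lambda>w. H (\<lambda>k\<in>{..<n}. state x0 t w k) :: real)"
proof -
  have "indep_pair borel (\<xi> t) (\<Pi>\<^sub>M k\<in>{..<n}. borel) (\<lambda>w. \<lambda>k\<in>{..<n}. state x0 t w k)"
    unfolding state_def
    by (rule uncertainty_indep_of_state[OF uncertainty_indep_vars independent L_carrier x0 nonlinearity_measurable])
  from indep_pair_compose[OF this f H] show ?thesis by (simp only: indep_pair_iff_indep_var)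
qed

lemma measurable_mat_app:
  "(\<lambda>f. mat_app L n f k) \<in> borel_measurable (\<Pi>\<^sub>M k\<in>{..<n}. borel)"
  unfolding mat_app_def
  by (intro borel_measurable_sum borel_measurable_times borel_measurable_const
      measurable_component_singleton)

lemma mat_app_restrict: "mat_app L n (\<lambda>k\<in>{..<n}. x k) = mat_app L n x"
  by (simp add: mat_app_def fun_eq_iff)

text \<open>
The only product of random quantities in the dynamics is that of the uncertainty and a linear
function of the state. Its second moment is finite because the two are independent.
\<close>

lemma square_integrable_state:
  assumes x0: "x0 \<in> carrier_vec n"
  shows "k < n \<Longrightarrow> square_integrable M (\<lambda>w. state x0 t w k)"
proof (induction t arbitrary: k)
  case 0
  show ?case by (simp add: state_def square_integrable_def)
next
  case (Suc t)
  note IH = Suc.IH and k = \<open>k < n\<close>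
  let ?y = "\<lambda>w. mat_app L n (state x0 t w) k"
  have y: "square_integrable M ?y" using IH by (rule square_integrable_mat_app)
  have sq: "(\<lambda>f. (mat_app L n f k)\<^sup>2) \<in> borel_measurable (\<Pi>\<^sub>M k\<in>{..<n}. borel)"
    using measurable_mat_app by (rule borel_measurable_power)
  have "indep_var borel (\<lambda>w. (\<xi> t w)\<^sup>2) borel (\<lambda>w. (?y w)\<^sup>2)"
    using uncertainty_indep_functional[OF x0 _ sq, of "\<lambda>s. s\<^sup>2" t]
    by (simp add: mat_app_restrict)
  from indep_var_integrable[OF this]
  have "integrable M (\<lambda>w. (\<xi> t w)\<^sup>2 * (?y w)\<^sup>2)"
    using y square_integrable_uncertainty[of t] by (simp add: square_integrable_def)
  then have "square_integrable M (\<lambda>w. \<xi> t w * ?y w)"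
    using y square_integrable_uncertainty[of t]
    by (auto simp: square_integrable_def power_mult_distrib intro!: borel_measurable_times)
  from square_integrable_cmult[OF this, of g]
  have "square_integrable M (\<lambda>w. (\<xi> t w * g) * ?y w)" by (simp add: ac_simps)
  then have linear: "square_integrable M (\<lambda>w. linear_part x0 t w k)"
    unfolding linear_part_def by (intro square_integrable_diff square_integrable_cmult IH[OF k] y)
  have nonlinear: "square_integrable M (\<lambda>w. state x0 t w k / \<delta> - \<phi> (state x0 t w k) t)"
  proof (rule square_integrable_bound)
    show "square_integrable M (\<lambda>w. (1 / \<delta>) * state x0 t w k)"
      using IH[OF k] by (rule square_integrable_cmult)
    show "(\<lambda>w. state x0 t w k / \<delta> - \<phi> (state x0 t w k) t) \<in> borel_measurable M"
      using measurable_state[OF x0 k] measurable_compose[OF measurable_state[OF x0 k] nonlinearity_measurable]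
      by simp
    (* The sector condition at the origin forces \<phi> to vanish there. *)
    have "0 \<le> \<phi> 0 t * (0 - \<delta> / 2 * \<phi> 0 t)"
      using admissible by (simp add: admissible_nonlinearity_def)
    then have "\<delta> / 2 * (\<phi> 0 t)\<^sup>2 \<le> 0" by (simp add: power2_eq_square algebra_simps)
    then have phi0: "\<phi> 0 t = 0" using delta_pos by (simp add: mult_le_0_iff)
    fix w
    have "(state x0 t w k / \<delta> - \<phi> (state x0 t w k) t)\<^sup>2 \<le> ((1 / \<delta>) * state x0 t w k)\<^sup>2"
      using admissible_centered_contraction[OF admissible delta_pos, of "state x0 t w k" t 0]
      by (simp add: phi0 power2_commute power_divide)
    then show "\<bar>state x0 t w k / \<delta> - \<phi> (state x0 t w k) t\<bar> \<le> \<bar>(1 / \<delta>) * state x0 t w k\<bar>"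
      by (simp only: abs_le_square_iff)
  qed
  show ?case
    unfolding state_Suc[OF x0 k]
    by (intro square_integrable_add linear nonlinear square_integrable_noise[OF k])
qed

lemma integrable_state_disagreement:
  "x0 \<in> carrier_vec n \<Longrightarrow> integrable M (\<lambda>w. disagreement n (state x0 t w))"
  using square_integrable_state by (rule integrable_disagreement)

text \<open>
The disagreement of the linear part is a quadratic polynomial in \<open>\<xi>(t)\<close> whose coefficients are
functions of the state. By independence its expectation is obtained by inserting the moments \<open>0\<close>
and \<open>\<sigma>\<^sup>2\<close>, and the result is bounded pathwise by the spectral estimate.
\<close>

lemma expectation_linear_part:
  assumes x0: "x0 \<in> carrier_vec n" and n: "2 \<le> n"
    and lam: "ordered_eigenvalues L n lam"
    and bound: "\<And>i. i \<in> {2..n} \<Longrightarrow> alpha_sq a g \<mu> \<sigma> \<delta> (lam i) \<le> m"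
  shows "integrable M (\<lambda>w. disagreement n (linear_part x0 t w))"
    and "expectation (\<lambda>w. disagreement n (linear_part x0 t w)) \<le> m * expectation (\<lambda>w. disagreement n (state x0 t w))"
proof -
  define u where "u = (\<lambda>f k. (a - 1 / \<delta>) * f k - (\<mu> * g) * mat_app L n f k)"
  let ?x = "state x0 t" and ?y = "\<lambda>w. mat_app L n (state x0 t w)"
  note x = square_integrable_state[OF x0, of _ t]
  have y: "square_integrable M (\<lambda>w. ?y w k)" for k
    using x by (rule square_integrable_mat_app)
  have u: "square_integrable M (\<lambda>w. u (?x w) k)" if "k < n" for k
    unfolding u_def by (intro square_integrable_diff square_integrable_cmult x that y)
  have Du: "integrable M (\<lambda>w. disagreement n (u (?x w)))" using u by (rule integrable_disagreement)
  have Dy: "integrable M (\<lambda>w. disagreement n (?y w))" using y by (rule integrable_disagreement)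
  have C: "integrable M (\<lambda>w. codisagreement n (u (?x w)) (?y w))"
    using u y by (rule integrable_codisagreement)
  have meas_x: "(\<lambda>f. f k) \<in> borel_measurable (\<Pi>\<^sub>M k\<in>{..<n}. (borel :: real measure))" if "k < n" for k
    using that by (intro measurable_component_singleton) simp
  have meas_u: "(\<lambda>f. u f k) \<in> borel_measurable (\<Pi>\<^sub>M k\<in>{..<n}. borel)" if "k < n" for k
    unfolding u_def using meas_x[OF that] measurable_mat_app by simp
  have meas_C: "(\<lambda>f. codisagreement n (u f) (mat_app L n f)) \<in> borel_measurable (\<Pi>\<^sub>M k\<in>{..<n}. borel)"
    unfolding codisagreement_def
    by (intro borel_measurable_sum borel_measurable_times borel_measurable_diff meas_u measurable_mat_app) auto
  have meas_D: "(\<lambda>f. disagreement n (mat_app L n f)) \<in> borel_measurable (\<Pi>\<^sub>M k\<in>{..<n}. borel)"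
    unfolding disagreement_def
    by (intro borel_measurable_sum borel_measurable_power borel_measurable_diff measurable_mat_app)
  have C_restrict: "codisagreement n (u (\<lambda>k\<in>{..<n}. f k)) h = codisagreement n (u f) h" for f h
    unfolding codisagreement_def by (intro sum.cong refl) (simp add: u_def mat_app_restrict)
  have ind_C: "indep_var borel (\<xi> t) borel (\<lambda>w. codisagreement n (u (?x w)) (?y w))"
    using uncertainty_indep_functional[OF x0 _ meas_C, of "\<lambda>s. s" t]
    by (simp add: mat_app_restrict C_restrict)
  have ind_D: "indep_var borel (\<lambda>w. (\<xi> t w)\<^sup>2) borel (\<lambda>w. disagreement n (?y w))"
    using uncertainty_indep_functional[OF x0 _ meas_D, of "\<lambda>s. s\<^sup>2" t]
    by (simp add: mat_app_restrict)
  have xi2: "integrable M (\<lambda>w. (\<xi> t w)\<^sup>2)"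
    using square_integrable_uncertainty by (simp add: square_integrable_def)
  note int_C = indep_var_integrable[OF ind_C integrable_uncertainty C]
  note int_D = indep_var_integrable[OF ind_D xi2 Dy]
  have A: "disagreement n (linear_part x0 t w) = disagreement n (u (?x w))
      - 2 * g * (\<xi> t w * codisagreement n (u (?x w)) (?y w))
      + g\<^sup>2 * ((\<xi> t w)\<^sup>2 * disagreement n (?y w))" for w
    unfolding linear_part_def using disagreement_diff_scaled[of n "u (?x w)" "\<xi> t w * g" "?y w"]
    by (simp add: u_def power_mult_distrib ac_simps)
  show "integrable M (\<lambda>w. disagreement n (linear_part x0 t w))"
    unfolding A using Du int_C int_D by simp
  have "expectation (\<lambda>w. disagreement n (linear_part x0 t w)) = expectation (\<lambda>w. disagreement n (u (?x w)))
      - 2 * g * expectation (\<lambda>w. \<xi> t w * codisagreement n (u (?x w)) (?y w))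
      + g\<^sup>2 * expectation (\<lambda>w. (\<xi> t w)\<^sup>2 * disagreement n (?y w))"
    unfolding A using Du int_C int_D by simp
  also have "\<dots> = expectation (\<lambda>w. disagreement n (u (?x w))
      + (\<sigma>\<^sup>2 * g\<^sup>2) * disagreement n (?y w))"
    unfolding indep_var_lebesgue_integral[OF ind_C integrable_uncertainty C]
      indep_var_lebesgue_integral[OF ind_D xi2 Dy] mean_uncertainty second_moment_uncertainty
    using Du Dy by (simp add: ac_simps)
  also have "\<dots> \<le> expectation (\<lambda>w. m * disagreement n (?x w))"
  proof (rule integral_mono)
    fix w
    have "((a - 1 / \<delta>) - (\<mu> * g) * lam i)\<^sup>2 + (\<sigma>\<^sup>2 * g\<^sup>2) * (lam i)\<^sup>2 \<le> m" if "i \<in> {2..n}" for i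
      using bound[OF that] by (simp add: alpha_sq_def ac_simps)
    from disagreement_spectral_bound[OF laplacian n lam this]
    show "disagreement n (u (?x w)) + (\<sigma>\<^sup>2 * g\<^sup>2) * disagreement n (?y w) \<le> m * disagreement n (?x w)"
      by (simp add: u_def)
  qed (use Du Dy integrable_state_disagreement[OF x0] in auto)
  finally show "expectation (\<lambda>w. disagreement n (linear_part x0 t w)) \<le> m * expectation (\<lambda>w. disagreement n (state x0 t w))"
    by simp
qed

lemma integrable_noise_disagreement: "integrable M (\<lambda>w. disagreement n (\<lambda>k. v t k w))"
  using square_integrable_noise by (rule integrable_disagreement)

text \<open>
Cross-correlations between the components are eliminated by \<open>(x - y)\<^sup>2 \<le> 2 x\<^sup>2 + 2 y\<^sup>2\<close>, so only
the diagonal of the covariance matters.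
\<close>

lemma expectation_noise_disagreement:
  "expectation (\<lambda>w. disagreement n (\<lambda>k. v t k w)) \<le> 4 * (real n)\<^sup>2 * spectral_norm R"
proof -
  have R: "R \<in> carrier_mat n n" using noise by (simp add: additive_noise_def)
  have int: "integrable M (\<lambda>w. (v t k w)\<^sup>2)" if "k < n" for k
    using square_integrable_noise[OF that] by (simp add: square_integrable_def)
  have E: "expectation (\<lambda>w. (v t k w)\<^sup>2) \<le> spectral_norm R" if "k < n" for k
    using noise that diagonal_le_spectral_norm[OF R that] by (simp add: additive_noise_def power2_eq_square)
  have "expectation (\<lambda>w. disagreement n (\<lambda>k. v t k w))
      \<le> expectation (\<lambda>w. \<Sum>i<n. \<Sum>j<n. 2 * (v t i w)\<^sup>2 + 2 * (v t j w)\<^sup>2)"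
  proof (rule integral_mono[OF integrable_noise_disagreement])
    show "integrable M (\<lambda>w. \<Sum>i<n. \<Sum>j<n. 2 * (v t i w)\<^sup>2 + 2 * (v t j w)\<^sup>2)"
      using int by (intro Bochner_Integration.integrable_sum Bochner_Integration.integrable_add) auto
    fix w
    have "(x - y)\<^sup>2 \<le> 2 * x\<^sup>2 + 2 * y\<^sup>2" for x y :: real
      using zero_le_power2[of "x + y"] by (simp add: power2_eq_square algebra_simps)
    then show "disagreement n (\<lambda>k. v t k w) \<le> (\<Sum>i<n. \<Sum>j<n. 2 * (v t i w)\<^sup>2 + 2 * (v t j w)\<^sup>2)"
      unfolding disagreement_def by (intro sum_mono)
  qed
  also have "\<dots> = (\<Sum>i<n. expectation (\<lambda>w. \<Sum>j<n. 2 * (v t i w)\<^sup>2 + 2 * (v t j w)\<^sup>2))"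
    using int by (intro Bochner_Integration.integral_sum Bochner_Integration.integrable_sum
        Bochner_Integration.integrable_add) auto
  also have "\<dots> = (\<Sum>i<n. \<Sum>j<n. expectation (\<lambda>w. 2 * (v t i w)\<^sup>2 + 2 * (v t j w)\<^sup>2))"
    using int by (intro sum.cong refl Bochner_Integration.integral_sum Bochner_Integration.integrable_add) auto
  also have "\<dots> = (\<Sum>i<n. \<Sum>j<n. 2 * expectation (\<lambda>w. (v t i w)\<^sup>2) + 2 * expectation (\<lambda>w. (v t j w)\<^sup>2))"
    by (intro sum.cong refl) (simp add: int)
  also have "\<dots> \<le> (\<Sum>i<n. \<Sum>j<n. 2 * spectral_norm R + 2 * spectral_norm R)"
    using E by (intro sum_mono add_mono mult_left_mono) auto
  also have "\<dots> = 4 * (real n)\<^sup>2 * spectral_norm R" by (simp add: power2_eq_square)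
  finally show ?thesis .
qed

text \<open>
The weights \<open>\<rho>\<close>, \<open>1 / \<delta>\<close> and \<open>1 - (\<rho> + 1 / \<delta>)\<close> are chosen so that the linear part, of squared
gain \<open>\<rho>\<^sup>2\<close>, contributes \<open>\<rho>\<close> and the nonlinearity, of squared gain \<open>1 / \<delta>\<^sup>2\<close>, contributes \<open>1 / \<delta>\<close>.
\<close>

lemma expected_disagreement_Suc:
  assumes x0: "x0 \<in> carrier_vec n" and n: "2 \<le> n"
    and lam: "ordered_eigenvalues L n lam"
    and bound: "\<And>i. i \<in> {2..n} \<Longrightarrow> alpha_sq a g \<mu> \<sigma> \<delta> (lam i) \<le> \<rho>\<^sup>2"
    and \<rho>: "0 < \<rho>" "\<rho> + 1 / \<delta> < 1"
  shows "expectation (\<lambda>w. disagreement n (state x0 (Suc t) w))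
    \<le> (\<rho> + 1 / \<delta>) * expectation (\<lambda>w. disagreement n (state x0 t w))
      + 4 * (real n)\<^sup>2 * spectral_norm R / (1 - (\<rho> + 1 / \<delta>))"
proof -
  define r where "r = 1 - (\<rho> + 1 / \<delta>)"
  have r: "0 < r" "\<rho> + 1 / \<delta> + r = 1" using \<rho> by (auto simp: r_def)
  let ?A = "linear_part x0 t"
  note lin = expectation_linear_part[OF x0 n lam bound, of t]
  let ?D = "\<lambda>w. disagreement n (state x0 t w)" and ?V = "\<lambda>w. disagreement n (\<lambda>k. v t k w)"
  have "expectation (\<lambda>w. disagreement n (state x0 (Suc t) w))
      \<le> expectation (\<lambda>w. disagreement n (?A w) / \<rho> + ?D w / \<delta> + ?V w / r)"
  proof (rule integral_mono)
    fix w
    let ?N = "\<lambda>k. state x0 t w k / \<delta> - \<phi> (state x0 t w k) t"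
    have "disagreement n (state x0 (Suc t) w) = disagreement n (\<lambda>k. ?A w k + ?N k + v t k w)"
      unfolding disagreement_def
      by (intro sum.cong refl) (simp only: state_Suc[OF x0] lessThan_iff)
    also have "\<dots> \<le> disagreement n (?A w) / \<rho> + disagreement n ?N / (1 / \<delta>) + ?V w / r"
      using \<rho> r delta_pos by (intro disagreement_convex_split) auto
    also have "disagreement n ?N / (1 / \<delta>) \<le> ?D w / \<delta>"
    proof -
      have "disagreement n ?N * \<delta> \<le> ?D w / \<delta>\<^sup>2 * \<delta>"
        using disagreement_centered_nonlinearity[OF admissible delta_pos] delta_pos
        by (intro mult_right_mono) auto
      then show ?thesis using delta_pos by (simp add: power2_eq_square)
    qed
    finally show "disagreement n (state x0 (Suc t) w) \<le> disagreement n (?A w) / \<rho> + ?D w / \<delta> + ?V w / r"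
      by simp
  qed (use lin integrable_noise_disagreement integrable_state_disagreement[OF x0] in auto)
  also have "\<dots> = expectation (\<lambda>w. disagreement n (?A w)) / \<rho> + expectation ?D / \<delta> + expectation ?V / r"
    using lin integrable_noise_disagreement[of t] integrable_state_disagreement[OF x0, of t] by simp
  also have "\<dots> \<le> \<rho> * expectation ?D + expectation ?D / \<delta> + 4 * (real n)\<^sup>2 * spectral_norm R / r"
  proof (intro add_mono order_refl divide_right_mono expectation_noise_disagreement)
    have "expectation (\<lambda>w. disagreement n (?A w)) / \<rho> \<le> \<rho>\<^sup>2 * expectation ?D / \<rho>"
      using lin(2) \<rho> by (intro divide_right_mono) auto
    then show "expectation (\<lambda>w. disagreement n (?A w)) / \<rho> \<le> \<rho> * expectation ?D"
      using \<rho> by (simp add: power2_eq_square)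
  qed (use r in simp)
  finally show ?thesis by (simp add: r_def algebra_simps)
qed

lemma expected_disagreement_bound:
  assumes x0: "x0 \<in> carrier_vec n" and n: "2 \<le> n"
    and lam: "ordered_eigenvalues L n lam"
    and bound: "\<And>i. i \<in> {2..n} \<Longrightarrow> alpha_sq a g \<mu> \<sigma> \<delta> (lam i) \<le> \<rho>\<^sup>2"
    and \<rho>: "0 < \<rho>" "\<rho> + 1 / \<delta> < 1"
  shows "expectation (\<lambda>w. disagreement n (state x0 t w))
    \<le> (\<rho> + 1 / \<delta>) ^ t * disagreement n (\<lambda>k. x0 $ k)
      + 4 * (real n)\<^sup>2 * spectral_norm R / (1 - (\<rho> + 1 / \<delta>))\<^sup>2"
proof -
  define T where "T = 4 * (real n)\<^sup>2 * spectral_norm R"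
  define \<beta> where "\<beta> = \<rho> + 1 / \<delta>"
  have \<beta>: "0 < \<beta>" "\<beta> < 1" using \<rho> delta_pos by (auto simp: \<beta>_def add_pos_pos)
  have T: "0 \<le> T"
  proof -
    have "0 \<le> expectation (\<lambda>w. disagreement n (\<lambda>k. v 0 k w))"
      by (rule Bochner_Integration.integral_nonneg) (simp add: disagreement_nonneg)
    also have "\<dots> \<le> T" unfolding T_def by (rule expectation_noise_disagreement)
    finally show ?thesis .
  qed
  have "expectation (\<lambda>w. disagreement n (state x0 t w))
      \<le> \<beta> ^ t * disagreement n (\<lambda>k. x0 $ k) + T / (1 - \<beta>)\<^sup>2"
  proof (induction t)
    case 0
    have "(state x0 0 w) = (\<lambda>k. x0 $ k)" for w by (simp add: state_def fun_eq_iff)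
    then show ?case using T by (simp add: prob_space)
  next
    case (Suc t)
    have "expectation (\<lambda>w. disagreement n (state x0 (Suc t) w))
        \<le> \<beta> * expectation (\<lambda>w. disagreement n (state x0 t w)) + T / (1 - \<beta>)"
      using expected_disagreement_Suc[OF assms] by (simp add: \<beta>_def T_def)
    also have "\<dots> \<le> \<beta> * (\<beta> ^ t * disagreement n (\<lambda>k. x0 $ k) + T / (1 - \<beta>)\<^sup>2) + T / (1 - \<beta>)"
      using Suc \<beta> by (intro add_right_mono mult_left_mono) auto
    also have "T / (1 - \<beta>) = (1 - \<beta>) * (T / (1 - \<beta>)\<^sup>2)"
      using \<beta> by (simp add: power2_eq_square)
    also have "\<beta> * (\<beta> ^ t * disagreement n (\<lambda>k. x0 $ k) + T / (1 - \<beta>)\<^sup>2) + (1 - \<beta>) * (T / (1 - \<beta>)\<^sup>2)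
        = \<beta> ^ Suc t * disagreement n (\<lambda>k. x0 $ k) + T / (1 - \<beta>)\<^sup>2"
      by (simp only: power_Suc distrib_left left_diff_distrib)
    finally show ?case .
  qed
  then show ?thesis by (simp add: \<beta>_def T_def)
qed

text \<open>
The difference of any pair is bounded by the total disagreement, which decays. What has to be
arranged is that the initial disagreement is bounded by a multiple of the initial difference of the
same pair, with a factor depending only on the matrix of squared initial differences.
\<close>

lemma mean_square_exp_synchronizing_if_contractive:
  assumes n: "2 \<le> n"
    and lam: "ordered_eigenvalues L n lam"
    and bound: "\<And>i. i \<in> {2..n} \<Longrightarrow> alpha_sq a g \<mu> \<sigma> \<delta> (lam i) \<le> \<rho>\<^sup>2"
    and \<rho>: "0 < \<rho>" "\<rho> + 1 / \<delta> < 1"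
  shows "mean_square_exp_synchronizing M n (network_state L a g \<mu> \<phi> \<xi> v) R"
proof -
  define \<beta> where "\<beta> = \<rho> + 1 / \<delta>"
  have \<beta>: "0 < \<beta>" "\<beta> < 1" using \<rho> delta_pos by (auto simp: \<beta>_def add_pos_pos)
  define c where "c = 4 * (real n)\<^sup>2 / (1 - \<beta>)\<^sup>2"
  have c: "0 < c" using n \<beta> by (simp add: c_def)
  define total where "total e = (\<Sum>i<n. \<Sum>l<n. \<bar>e $$ (i, l)\<bar>)" for e :: "real mat"
  (* Summing over all pairs avoids choosing the smallest nonzero difference: the pair at hand is one
     of the summands, and a vanishing entry contributes nothing because x / 0 = 0. *)
  define Kbar where "Kbar e = 1 + (\<Sum>k<n. \<Sum>j<n. total e / \<bar>e $$ (k, j)\<bar>)" for e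
  have total: "0 \<le> total e" for e by (simp add: total_def sum_nonneg)
  have Kbar: "0 < Kbar e" for e
    using total by (auto simp: Kbar_def intro!: add_pos_nonneg sum_nonneg)
  have initial: "disagreement n (\<lambda>i. x0 $ i) \<le> Kbar (initial_differences n x0) * (x0 $ k - x0 $ j)\<^sup>2"
    if kj: "k < n" "j < n" and apart: "x0 $ k \<noteq> x0 $ j \<or> (\<forall>i<n. \<forall>l<n. x0 $ i = x0 $ l)" for x0 k j
  proof (cases "x0 $ k = x0 $ j")
    case True
    then have all: "\<forall>i<n. \<forall>l<n. x0 $ i = x0 $ l" using apart by blast
    have "disagreement n (\<lambda>i. x0 $ i) = 0"
      unfolding disagreement_def
    proof (intro sum.neutral ballI)
      fix i l assume "i \<in> {..<n}" "l \<in> {..<n}"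
      then have "x0 $ i = x0 $ l" using all by blast
      then show "(x0 $ i - x0 $ l)\<^sup>2 = 0" by simp
    qed
    then show ?thesis using Kbar[of "initial_differences n x0"] by simp
  next
    case False
    define e where "e = initial_differences n x0"
    have e: "e $$ (i, l) = (x0 $ i - x0 $ l)\<^sup>2" if "i < n" "l < n" for i l
      using that by (simp add: e_def initial_differences_def)
    have D: "disagreement n (\<lambda>i. x0 $ i) = total e"
      by (simp add: disagreement_def total_def e)
    have "total e / \<bar>e $$ (k, j)\<bar> \<le> (\<Sum>j<n. total e / \<bar>e $$ (k, j)\<bar>)"
      using kj total by (intro member_le_sum) auto
    also have "\<dots> \<le> (\<Sum>k<n. \<Sum>j<n. total e / \<bar>e $$ (k, j)\<bar>)"
      using kj total
      by (intro member_le_sum[of k _ "\<lambda>k. \<Sum>j<n. total e / \<bar>e $$ (k, j)\<bar>"]) (auto intro!: sum_nonneg)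
    also have "\<dots> \<le> Kbar e" by (simp add: Kbar_def)
    finally have "total e / (x0 $ k - x0 $ j)\<^sup>2 \<le> Kbar e" using kj by (simp add: e)
    then show ?thesis using False by (simp add: D e_def[symmetric] pos_divide_le_eq)
  qed
  have main: "integrable M (\<lambda>w. (state x0 t w k - state x0 t w j)\<^sup>2) \<and>
      expectation (\<lambda>w. (state x0 t w k - state x0 t w j)\<^sup>2)
        \<le> Kbar (initial_differences n x0) * \<beta> ^ t * (x0 $ k - x0 $ j)\<^sup>2 + c * spectral_norm R"
    if x0: "x0 \<in> carrier_vec n" and kj: "k < n" "j < n"
      and apart: "x0 $ k \<noteq> x0 $ j \<or> (\<forall>i<n. \<forall>l<n. x0 $ i = x0 $ l)" for x0 k j t
  proof
    show int: "integrable M (\<lambda>w. (state x0 t w k - state x0 t w j)\<^sup>2)"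
      using square_integrable_diff[OF square_integrable_state[OF x0 kj(1)] square_integrable_state[OF x0 kj(2)]]
      by (simp add: square_integrable_def)
    have "expectation (\<lambda>w. (state x0 t w k - state x0 t w j)\<^sup>2) \<le> expectation (\<lambda>w. disagreement n (state x0 t w))"
      using int integrable_state_disagreement[OF x0] pair_le_disagreement[OF kj] by (rule integral_mono)
    also have "\<dots> \<le> \<beta> ^ t * disagreement n (\<lambda>i. x0 $ i) + c * spectral_norm R"
      using expected_disagreement_bound[OF x0 n lam bound \<rho>, of t] by (simp add: \<beta>_def c_def)
    also have "\<dots> \<le> \<beta> ^ t * (Kbar (initial_differences n x0) * (x0 $ k - x0 $ j)\<^sup>2) + c * spectral_norm R"
      using initial[OF kj apart] \<beta> by (intro add_right_mono mult_left_mono) auto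
    finally show "expectation (\<lambda>w. (state x0 t w k - state x0 t w j)\<^sup>2)
        \<le> Kbar (initial_differences n x0) * \<beta> ^ t * (x0 $ k - x0 $ j)\<^sup>2 + c * spectral_norm R"
      by (simp add: ac_simps)
  qed
  show ?thesis
    unfolding mean_square_exp_synchronizing_def
  proof (rule exI[of _ \<beta>], rule exI[of _ "Kbar (0\<^sub>m n n)"], rule exI[of _ c], rule exI[of _ Kbar],
      intro conjI allI ballI impI)
    fix x0 :: "real vec" and k j t :: nat
    assume asm: "x0 \<in> carrier_vec n" "k < n" "j < n" "x0 $ k \<noteq> x0 $ j \<or> (\<forall>i<n. \<forall>l<n. x0 $ i = x0 $ l)"
    note main = main[OF asm, of t, unfolded state_def]
    show "integrable M (\<lambda>w. (network_state L a g \<mu> \<phi> \<xi> v x0 t w $ k - network_state L a g \<mu> \<phi> \<xi> v x0 t w $ j)\<^sup>2)"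
      using main by (rule conjunct1)
    show "expectation (\<lambda>w. (network_state L a g \<mu> \<phi> \<xi> v x0 t w $ k - network_state L a g \<mu> \<phi> \<xi> v x0 t w $ j)\<^sup>2)
        \<le> Kbar (initial_differences n x0) * \<beta> ^ t * (x0 $ k - x0 $ j)\<^sup>2 + c * spectral_norm R"
      using main by (rule conjunct2)
  qed (fact \<beta> c Kbar refl)+
qed

end

section \<open>The parametrized condition and the eigenvalue condition\<close>

text \<open>
Convexity in \<open>l\<close>: the chord through the endpoints exceeds the parabola by its nonnegative leading
coefficient times \<open>(l - l1) (l2 - l)\<close>.
\<close>

lemma alpha_sq_le_max_endpoints:
  fixes l :: real
  assumes "l1 \<le> l" "l \<le> l2"
  shows "alpha_sq a g \<mu> \<sigma> \<delta> l \<le> max (alpha_sq a g \<mu> \<sigma> \<delta> l1) (alpha_sq a g \<mu> \<sigma> \<delta> l2)"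
proof -
  define A where "A = a - 1 / \<delta>"
  define B where "B = \<mu> * g"
  define C where "C = \<sigma>\<^sup>2 * g\<^sup>2"
  have C: "0 \<le> C" by (simp add: C_def)
  define f where "f = alpha_sq a g \<mu> \<sigma> \<delta>"
  have f: "f x = A\<^sup>2 - 2 * A * B * x + (B\<^sup>2 + C) * x\<^sup>2" for x
    by (simp add: f_def alpha_sq_def A_def[symmetric] B_def C_def power2_diff power_mult_distrib algebra_simps)
  show ?thesis
  proof (cases "l1 = l2")
    case False
    then have pos: "0 < l2 - l1" using assms by simp
    have "(l2 - l1) * f l = (l2 - l) * f l1 + (l - l1) * f l2 - (B\<^sup>2 + C) * ((l2 - l1) * ((l - l1) * (l2 - l)))"
      unfolding f by (simp add: power2_eq_square algebra_simps)
    moreover have "0 \<le> (B\<^sup>2 + C) * ((l2 - l1) * ((l - l1) * (l2 - l)))"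
      using C assms by (intro mult_nonneg_nonneg) auto
    moreover have "(l2 - l) * f l1 \<le> (l2 - l) * max (f l1) (f l2)"
      "(l - l1) * f l2 \<le> (l - l1) * max (f l1) (f l2)"
      using assms by (auto intro!: mult_left_mono)
    ultimately have "(l2 - l1) * f l \<le> (l2 - l1) * max (f l1) (f l2)"
      by (simp add: algebra_simps)
    then show ?thesis using pos by (simp add: f_def)
  qed (use assms in simp)
qed

text \<open>
Solving the inequality for \<open>\<alpha>\<^sup>2\<close> gives \<open>\<alpha>\<^sup>2 < (1 - 1 / \<delta>)\<^sup>2 - (p - 1)\<^sup>2 / (\<delta> p)\<close>. The bound
\<open>\<delta> > 1\<close> comes from \<open>1 / \<delta> < p < \<delta>\<close>.
\<close>

lemma sync_condition_imp_alpha_sq_less: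
  assumes \<delta>: "0 < \<delta>" and p: "p < \<delta>" "0 < p"
    and ineq: "p > ((a - 1 / \<delta>) - \<mu> * l * g)\<^sup>2 * \<delta> * p / (\<delta> - p)
      + l\<^sup>2 * \<sigma>\<^sup>2 * (g\<^sup>2 * \<delta> * p / (\<delta> - p)) + 1 / \<delta>"
  shows "1 < \<delta>" "alpha_sq a g \<mu> \<sigma> \<delta> l < (1 - 1 / \<delta>)\<^sup>2"
proof -
  define \<alpha> where "\<alpha> = alpha_sq a g \<mu> \<sigma> \<delta> l"
  have \<alpha>: "0 \<le> \<alpha>" by (simp add: \<alpha>_def alpha_sq_def)
  have ineq': "\<alpha> * (\<delta> * p / (\<delta> - p)) + 1 / \<delta> < p"
    using ineq by (simp add: \<alpha>_def alpha_sq_def algebra_simps)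
  have pos: "0 < \<delta> * p / (\<delta> - p)" using p \<delta> by simp
  have "0 \<le> \<alpha> * (\<delta> * p / (\<delta> - p))" using \<alpha> pos by (intro mult_nonneg_nonneg) auto
  then have "1 / \<delta> < \<delta>" using ineq' p by linarith
  then have "1 < \<delta> * \<delta>" using \<delta> by (simp add: field_simps)
  then show "1 < \<delta>" using \<delta> by (metis less_1_mult mult_le_one not_less less_eq_real_def)
  have "\<alpha> < (p - 1 / \<delta>) / (\<delta> * p / (\<delta> - p))"
    unfolding pos_less_divide_eq[OF pos] using ineq' by linarith
  also have "\<dots> = (1 - 1 / \<delta>)\<^sup>2 - (p - 1)\<^sup>2 / (\<delta> * p)"
    using p \<delta> by (simp add: field_simps power2_eq_square)
  also have "\<dots> \<le> (1 - 1 / \<delta>)\<^sup>2" using p \<delta> by simp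
  finally show "alpha_sq a g \<mu> \<sigma> \<delta> l < (1 - 1 / \<delta>)\<^sup>2" by (simp add: \<alpha>_def)
qed

text \<open>
The choice \<open>p = 1\<close> makes the loss \<open>(p - 1)\<^sup>2 / (\<delta> p)\<close> of the previous lemma vanish.
\<close>

lemma alpha_sq_less_imp_sync_condition:
  assumes \<delta>: "1 < \<delta>" and less: "alpha_sq a g \<mu> \<sigma> \<delta> l < (1 - 1 / \<delta>)\<^sup>2"
  shows "1 > ((a - 1 / \<delta>) - \<mu> * l * g)\<^sup>2 * \<delta> * 1 / (\<delta> - 1)
      + l\<^sup>2 * \<sigma>\<^sup>2 * (g\<^sup>2 * \<delta> * 1 / (\<delta> - 1)) + 1 / \<delta>"
proof -
  have "alpha_sq a g \<mu> \<sigma> \<delta> l * (\<delta> / (\<delta> - 1)) < (1 - 1 / \<delta>)\<^sup>2 * (\<delta> / (\<delta> - 1))"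
    using less \<delta> by (intro mult_strict_right_mono) auto
  also have "\<dots> = 1 - 1 / \<delta>" using \<delta> by (simp add: field_simps power2_eq_square)
  finally show ?thesis by (simp add: alpha_sq_def algebra_simps)
qed

theorem theorem16:
  fixes M :: "'w measure"
    and N k d :: nat
    and a g \<mu> \<sigma> \<delta> :: real
    and \<phi> :: "real \<Rightarrow> nat \<Rightarrow> real"
    and \<xi> :: "nat \<Rightarrow> 'w \<Rightarrow> real"
    and v :: "nat \<Rightarrow> nat \<Rightarrow> 'w \<Rightarrow> real"
    and R :: "real mat"
    and lam :: "nat \<Rightarrow> real"
  assumes "prob_space M"
    and "1 \<le> k" and "k < N" and "1 \<le> d"
    and "0 < \<delta>"
    and "admissible_nonlinearity \<delta> \<phi>"
    and "link_uncertainty M \<xi> \<sigma>"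
    and "additive_noise M (N ^ d) v R"
    and "independent_processes M (N ^ d) \<xi> v"
    and "ordered_eigenvalues (torus_laplacian N k d) (N ^ d) lam"
  shows "((\<exists>p. sync_condition a g \<mu> \<sigma> \<delta> lam (N ^ d) p) \<longrightarrow>
            mean_square_exp_synchronizing M (N ^ d)
              (network_state (torus_laplacian N k d) a g \<mu> \<phi> \<xi> v) R) \<and>
         ((\<exists>p. sync_condition a g \<mu> \<sigma> \<delta> lam (N ^ d) p) \<longrightarrow>
            (1 - 1 / \<delta>)\<^sup>2 >
            max (alpha_sq a g \<mu> \<sigma> \<delta> (lam 2)) (alpha_sq a g \<mu> \<sigma> \<delta> (lam (N ^ d)))) \<and>
         (1 \<le> \<delta> \<longrightarrow>
            (1 - 1 / \<delta>)\<^sup>2 >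
            max (alpha_sq a g \<mu> \<sigma> \<delta> (lam 2)) (alpha_sq a g \<mu> \<sigma> \<delta> (lam (N ^ d))) \<longrightarrow>
            (\<exists>p. sync_condition a g \<mu> \<sigma> \<delta> lam (N ^ d) p))"
proof -
  define n where "n = N ^ d"
  define L where "L = torus_laplacian N k d"
  have "N \<le> N ^ d" using assms(2-4) by (intro self_le_power) auto
  then have n: "2 \<le> n" using assms(2,3) by (simp add: n_def)
  have lam: "ordered_eigenvalues L n lam" using assms(10) by (simp add: n_def L_def)
  define \<alpha> where "\<alpha> = max (alpha_sq a g \<mu> \<sigma> \<delta> (lam 2)) (alpha_sq a g \<mu> \<sigma> \<delta> (lam n))"
  have alpha_nonneg: "0 \<le> \<alpha>" by (simp add: \<alpha>_def alpha_sq_def le_max_iff_disj)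
  have alpha: "alpha_sq a g \<mu> \<sigma> \<delta> (lam i) \<le> \<alpha>" if "i \<in> {2..n}" for i
    unfolding \<alpha>_def using lam that
    by (intro alpha_sq_le_max_endpoints) (auto simp: ordered_eigenvalues_def mono_on_def)
  have necessary: "1 < \<delta> \<and> \<alpha> < (1 - 1 / \<delta>)\<^sup>2" if "sync_condition a g \<mu> \<sigma> \<delta> lam n p" for p
  proof -
    have cond: "p i < \<delta> \<and> 0 < p i \<and> p i > ((a - 1 / \<delta>) - \<mu> * lam i * g)\<^sup>2 * \<delta> * p i / (\<delta> - p i)
        + (lam i)\<^sup>2 * \<sigma>\<^sup>2 * (g\<^sup>2 * \<delta> * p i / (\<delta> - p i)) + 1 / \<delta>" if "i \<in> {2..n}" for i
      using \<open>sync_condition a g \<mu> \<sigma> \<delta> lam n p\<close> that by (auto simp: sync_condition_def)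
    show ?thesis
      using cond[of 2] cond[of n] n
        sync_condition_imp_alpha_sq_less[OF assms(5), of "p 2" a \<mu> "lam 2" g \<sigma>]
        sync_condition_imp_alpha_sq_less[OF assms(5), of "p n" a \<mu> "lam n" g \<sigma>]
      unfolding \<alpha>_def max_less_iff_conj by simp
  qed
  have synchronizing: "mean_square_exp_synchronizing M n (network_state L a g \<mu> \<phi> \<xi> v) R"
    if \<delta>: "1 < \<delta>" and less: "\<alpha> < (1 - 1 / \<delta>)\<^sup>2"
  proof -
    interpret prob_space M by fact
    interpret noisy_network M n L a g \<mu> \<sigma> \<delta> \<phi> \<xi> v R
      by unfold_locales (use assms graph_laplacian_torus in \<open>simp_all add: n_def L_def\<close>)
    have gap: "sqrt \<alpha> < 1 - 1 / \<delta>"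
      using less \<delta> by (intro real_less_lsqrt) auto
    (* Strictly above sqrt \<alpha>, so that \<rho> is positive even if \<alpha> is zero. *)
    define \<rho> where "\<rho> = (sqrt \<alpha> + (1 - 1 / \<delta>)) / 2"
    have "s < (s + e) / 2 \<and> 0 < (s + e) / 2 \<and> (s + e) / 2 < e" if "0 \<le> s" "s < e" for s e :: real
      using that by simp
    from this[OF real_sqrt_ge_zero[OF alpha_nonneg] gap]
    have \<rho>: "sqrt \<alpha> < \<rho> \<and> 0 < \<rho> \<and> \<rho> + 1 / \<delta> < 1"
      unfolding \<rho>_def[symmetric] by linarith
    then have "\<alpha> \<le> \<rho>\<^sup>2" using real_sqrt_le_iff[of \<alpha> "\<rho>\<^sup>2"] by simp
    then have "alpha_sq a g \<mu> \<sigma> \<delta> (lam i) \<le> \<rho>\<^sup>2" if "i \<in> {2..n}" for i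
      using alpha[OF that] by simp
    from mean_square_exp_synchronizing_if_contractive[OF n lam this] \<rho> show ?thesis by blast
  qed
  have sufficient: "sync_condition a g \<mu> \<sigma> \<delta> lam n (\<lambda>_. 1)"
    if \<delta>: "1 \<le> \<delta>" and less: "\<alpha> < (1 - 1 / \<delta>)\<^sup>2"
  proof -
    have "\<delta> \<noteq> 1" using less alpha_nonneg by auto
    then have "1 < \<delta>" using \<delta> by simp
    then show ?thesis
      unfolding sync_condition_def
      using alpha_sq_less_imp_sync_condition[OF \<open>1 < \<delta>\<close> le_less_trans[OF alpha less]] by auto
  qed
  show ?thesis
    unfolding n_def[symmetric] L_def[symmetric] \<alpha>_def[symmetric]
    using necessary synchronizing sufficient by blast
qed

end
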